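(* Let $(S_7,\cdot)$ be the three-element commutative monoid $\{0,a,1\}$ with identity $1$, zero $0$ and $a\cdot a=0$. The variety $\mathsf{V}(\mathcal{P}(S_7,\cdot))$ generated by the power semiring $\mathcal{P}(S_7,\cdot)$ is exactly the variety of all commutative ai-semirings satisfying the following identities and inequalities, where $\mathbf{q}_{n,k}=x_1x_2\cdots x_k x_{k+1}^2\cdots x_{n+1}^2$: (1) $x^3\approx x^2$; (2) $x_1^2x_2^2\cdots x_{n+1}^2\preceq \sum_{i=1}^{n+1}x_i^2\mathbf{w}_i$, for all $n\ge 1$; (3) $\mathbf{q}_{n,k}\preceq \sum_{i=1}^{k}x_i\mathbf{w}_i+\sum_{i=1}^{k-1}x_i^2\mathbf{w}_i'+\sum_{i=k+1}^{n+1}x_i^2\mathbf{w}_i$, for all $n\ge1$ and $1\le k\le n+1$; (4) $\mathbf{q}_{n,k}\preceq \sum_{i=1}^{k}x_i\mathbf{w}_i+\sum_{i=1}^{\ell}x_i^2\mathbf{w}_i'+\sum_{\ell+1\le i<j\le k}x_ix_j\mathbf{w}_{ij}+\sum_{i=k+1}^{n+1}x_i^2\mathbf{w}_i$, for all $n\ge1$, $1\le k\le n+1$ and $0\le \ell<k-1$. Here, in (2)--(4), $\mathbf{w}_i,\mathbf{w}_i'$ range over all (possibly empty) commutative words with $c(\mathbf{w}_i),c(\mathbf{w}_i')\subseteq\{x_1,\dots,x_{n+1}\}\setminus\{x_i\}$, and in (4) each $\mathbf{w}_{ij}$ ranges over all (possibly empty) commutative words with $c(\mathbf{w}_{ij}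)\subseteq\{x_1,\dots,x_{n+1}\}\setminus\{x_i,x_j\}$.
   Context: An ai-semiring is an algebra $(S,+,\cdot)$ with $(S,+)$ a commutative idempotent semigroup, $(S,\cdot)$ a semigroup, and multiplication distributing over addition on both sides; it is commutative if $\cdot$ is commutative. No constants are in the signature. For a semigroup $S$, $\mathcal{P}(S)$ is the ai-semiring of all subsets of $S$ (including $\emptyset$) with $A+B=A\cup B$ and $AB=\{ab\mid a\in A,b\in B\}$. $\mathsf{V}(A)$ is the variety generated by $A$. $X$ is a countably infinite set of variables, whose members include the pairwise distinct variables $x,x_1,x_2,\dots$. $X_c^+$ is the free commutative semigroup over $X$ (its elements are called words), and $c(\mathbf{w})$ is the set of variables occurring in $\mathbf{w}$ (empty for the empty word). Terms are finite nonempty sets of words, written as formal sums. For terms $\mathbf{u},\mathbf{v}$, the inequality $\mathbf{u}\preceq\mathbf{v}$ denotes the identity $\mathbf{v}\approx\mathbf{v}+\mathbf{u}$. Empty sums are simply omitted. *)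

theory Defs
  imports
    "HOL-Library.Multiset"
    "HOL-Library.FuncSet"
    "HOL-Library.Set_Algebras"
begin

record 'a alg =
  carr :: "'a set"
  add :: "'a \<Rightarrow> 'a \<Rightarrow> 'a" (infixl "\<oplus>\<index>" 65)
  mul :: "'a \<Rightarrow> 'a \<Rightarrow> 'a" (infixl "\<otimes>\<index>" 70)

locale ai_semiring =
  fixes S :: "'a alg" (structure)
  assumes nonempty: "carr S \<noteq> {}"
    and add_closed: "\<lbrakk>x \<in> carr S; y \<in> carr S\<rbrakk> \<Longrightarrow> x \<oplus> y \<in> carr S"
    and mul_closed: "\<lbrakk>x \<in> carr S; y \<in> carr S\<rbrakk> \<Longrightarrow> x \<otimes> y \<in> carr S"
    and add_assoc: "\<lbrakk>x \<in> carr S; y \<in> carr S; z \<in> carr S\<rbrakk> \<Longrightarrow> (x \<oplus> y) \<oplus> z = x \<oplus> (y \<oplus> z)"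
    and add_comm: "\<lbrakk>x \<in> carr S; y \<in> carr S\<rbrakk> \<Longrightarrow> x \<oplus> y = y \<oplus> x"
    and add_idem: "x \<in> carr S \<Longrightarrow> x \<oplus> x = x"
    and mul_assoc: "\<lbrakk>x \<in> carr S; y \<in> carr S; z \<in> carr S\<rbrakk> \<Longrightarrow> (x \<otimes> y) \<otimes> z = x \<otimes> (y \<otimes> z)"
    and distrib_left: "\<lbrakk>x \<in> carr S; y \<in> carr S; z \<in> carr S\<rbrakk> \<Longrightarrow> x \<otimes> (y \<oplus> z) = (x \<otimes> y) \<oplus> (x \<otimes> z)"
    and distrib_right: "\<lbrakk>x \<in> carr S; y \<in> carr S; z \<in> carr S\<rbrakk> \<Longrightarrow> (x \<oplus> y) \<otimes> z = (x \<otimes> z) \<oplus> (y \<otimes> z)"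

locale comm_ai_semiring = ai_semiring +
  assumes mul_comm: "\<lbrakk>x \<in> carr S; y \<in> carr S\<rbrakk> \<Longrightarrow> x \<otimes> y = y \<otimes> x"

text \<open>All subsets of the semigroup, the empty one included; the multiplication is the
  elementwise product of sets from \<open>Set_Algebras\<close>.\<close>

definition power_semiring :: "'a::semigroup_mult set alg" where
  "power_semiring = \<lparr>carr = UNIV, add = (\<union>), mul = (*)\<rparr>"

lemma power_semiring_mul: "mul power_semiring A B = {a * b | a b. a \<in> A \<and> b \<in> B}"
  by (auto simp: power_semiring_def set_times_def)

lemma ai_semiring_power_semiring: "ai_semiring (power_semiring :: 'a::semigroup_mult set alg)"
  by unfold_locales (auto simp: power_semiring_def set_times_def mult.assoc, (metis mult.assoc)+)

lemma comm_ai_semiring_power_semiring: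
  "comm_ai_semiring (power_semiring :: 'a::ab_semigroup_mult set alg)"
proof -
  interpret ai_semiring "power_semiring :: 'a set alg"
    by (rule ai_semiring_power_semiring)
  show ?thesis
    by unfold_locales (simp add: power_semiring_def mult.commute)
qed

datatype S7 = Zero7 | A7 | One7

instantiation S7 :: "{zero, comm_monoid_mult, mult_zero}"
begin

definition zero_S7 :: S7 where "0 = Zero7"

definition one_S7 :: S7 where "1 = One7"

fun times_S7 :: "S7 \<Rightarrow> S7 \<Rightarrow> S7" where
  "One7 * y = y"
| "x * One7 = x"
| "_ * _ = Zero7"

instance
proof
  fix x y z :: S7
  show "x * y * z = x * (y * z)" by (cases x; cases y; cases z) simp_all
  show "x * y = y * x" by (cases x; cases y) simp_all
  show "1 * x = x" by (simp add: one_S7_def)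
  show "0 * x = 0" by (cases x) (simp_all add: zero_S7_def)
  show "x * 0 = 0" by (cases x) (simp_all add: zero_S7_def)
qed

end

lemma A7_square: "A7 * A7 = 0"
  by (simp add: zero_S7_def)

text \<open>The variety generated by an algebra is taken as the class of all homomorphic images of
  subalgebras of its direct powers (HSP).\<close>

definition direct_power :: "'i set \<Rightarrow> 'a alg \<Rightarrow> ('i \<Rightarrow> 'a) alg" where
  "direct_power I A =
    \<lparr>carr = I \<rightarrow>\<^sub>E carr A,
     add = (\<lambda>f g. \<lambda>i\<in>I. add A (f i) (g i)),
     mul = (\<lambda>f g. \<lambda>i\<in>I. mul A (f i) (g i))\<rparr>"

definition subuniverse :: "'a set \<Rightarrow> 'a alg \<Rightarrow> bool" where
  "subuniverse U A \<longleftrightarrow> U \<noteq> {} \<and> U \<subseteq> carr A \<and>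
    (\<forall>x\<in>U. \<forall>y\<in>U. add A x y \<in> U \<and> mul A x y \<in> U)"

definition hom_onto :: "('a \<Rightarrow> 'b) \<Rightarrow> 'a alg \<Rightarrow> 'b alg \<Rightarrow> bool" where
  "hom_onto h A B \<longleftrightarrow> h ` carr A = carr B \<and>
    (\<forall>x\<in>carr A. \<forall>y\<in>carr A. h (add A x y) = add B (h x) (h y) \<and> h (mul A x y) = mul B (h x) (h y))"

definition image_of_subpower :: "'a alg \<Rightarrow> 'i set \<Rightarrow> 'b alg \<Rightarrow> bool" where
  "image_of_subpower A I B \<longleftrightarrow>
    (\<exists>U h. subuniverse U (direct_power I A) \<and> hom_onto h (direct_power I A\<lparr>carr := U\<rparr>) B)"

text \<open>One cannot quantify existentially over the type of the index set. Index sets of type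
  \<open>('b \<Rightarrow> 'a) set\<close> suffice to reach every algebra of type \<open>'b alg\<close>: this is
  \<open>variety_generatedI\<close> below, in which the type of the index set is arbitrary.\<close>

definition variety_generated :: "'a alg \<Rightarrow> 'b alg set" where
  "variety_generated A = {B. \<exists>I :: ('b \<Rightarrow> 'a) set. image_of_subpower A I B}"

lemma variety_generatedI:
  fixes A :: "'a alg" and B :: "'b alg" and I :: "'i set"
  assumes "image_of_subpower A I B"
  shows "B \<in> variety_generated A"
proof -
  from assms obtain U h where sub: "subuniverse U (direct_power I A)"
    and hom: "hom_onto h (direct_power I A\<lparr>carr := U\<rparr>) B"
    by (auto simp: image_of_subpower_def)
  have UI: "f \<in> I \<rightarrow>\<^sub>E carr A" if "f \<in> U" for f
    using sub that by (auto simp: subuniverse_def direct_power_def)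
  have h_img: "h ` U = carr B"
    using hom by (simp add: hom_onto_def)
  define u where "u b = (SOME f. f \<in> U \<and> h f = b)" for b
  have u: "u b \<in> U" "h (u b) = b" if "b \<in> carr B" for b
  proof -
    have "\<exists>f. f \<in> U \<and> h f = b" using that by (metis h_img imageE)
    from someI_ex[OF this] show "u b \<in> U" "h (u b) = b" by (simp_all add: u_def)
  qed
  \<comment> \<open>Two coordinates are identified if they agree on the chosen preimages.\<close>
  define r where "r i = (\<lambda>b. if b \<in> carr B then u b i else undefined)" for i
  define J where "J = r ` I"
  define s where "s j = (SOME i. i \<in> I \<and> r i = j)" for j
  have s: "s j \<in> I" "r (s j) = j" if "j \<in> J" for j
  proof -
    have "\<exists>i. i \<in> I \<and> r i = j" using that by (auto simp: J_def)
    from someI_ex[OF this] show "s j \<in> I" "r (s j) = j" by (simp_all add: s_def)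
  qed
  define V where "V = {f \<in> U. \<forall>i\<in>I. f i = f (s (r i))}"
  define p where "p f = (\<lambda>j\<in>J. f (s j))" for f :: "'i \<Rightarrow> 'a"
  have rs: "s (r i) \<in> I" "r (s (r i)) = r i" if "i \<in> I" for i
    using s[of "r i"] that by (auto simp: J_def)
  have u_V: "u b \<in> V" if "b \<in> carr B" for b
  proof -
    have "u b i = u b (s (r i))" if "i \<in> I" for i
      using fun_cong[OF rs(2)[OF that], of b] \<open>b \<in> carr B\<close> by (simp add: r_def)
    then show ?thesis using u(1)[OF that] by (simp add: V_def)
  qed
  have p_inj: "f = g" if fg: "f \<in> V" "g \<in> V" and eq: "p f = p g" for f g
  proof (rule PiE_ext)
    show "f \<in> I \<rightarrow>\<^sub>E carr A" "g \<in> I \<rightarrow>\<^sub>E carr A"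
      using fg UI by (auto simp: V_def)
    fix i assume i: "i \<in> I"
    then have "r i \<in> J" by (simp add: J_def)
    then have "f (s (r i)) = g (s (r i))"
      using fun_cong[OF eq, of "r i"] by (simp add: p_def)
    then show "f i = g i" using fg i by (simp add: V_def)
  qed
  have U_op: "add (direct_power I A) f g \<in> U" "mul (direct_power I A) f g \<in> U"
    if "f \<in> U" "g \<in> U" for f g
    using sub that by (auto simp: subuniverse_def)
  have V_op: "add (direct_power I A) f g \<in> V" "mul (direct_power I A) f g \<in> V"
    if "f \<in> V" "g \<in> V" for f g
    using that U_op[of f g] rs(1) by (auto simp: V_def direct_power_def)
  have p_op: "p (add (direct_power I A) f g) = add (direct_power J A) (p f) (p g)"
    "p (mul (direct_power I A) f g) = mul (direct_power J A) (p f) (p g)" for f g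
    using s(1) by (auto simp: p_def direct_power_def fun_eq_iff)
  define q where "q = the_inv_into V p"
  have inj: "inj_on p V" using p_inj by (auto simp: inj_on_def)
  have q: "q (p f) = f" if "f \<in> V" for f
    using the_inv_into_f_f[OF inj that] by (simp add: q_def)
  have "subuniverse (p ` V) (direct_power J A)"
  proof -
    have "V \<noteq> {}" using sub h_img u_V by (auto simp: subuniverse_def)
    moreover have "p ` V \<subseteq> carr (direct_power J A)"
      using UI s(1) by (force simp: V_def p_def direct_power_def)
    ultimately show ?thesis
      using V_op p_op by (auto simp: subuniverse_def simp flip: p_op)
  qed
  moreover have "hom_onto (h \<circ> q) (direct_power J A\<lparr>carr := p ` V\<rparr>) B"
  proof -
    have "V \<subseteq> U" by (auto simp: V_def)
    have "h ` V = carr B"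
    proof
      show "h ` V \<subseteq> carr B" using \<open>V \<subseteq> U\<close> h_img by blast
      show "carr B \<subseteq> h ` V" using u(2) u_V by (metis image_eqI subsetI)
    qed
    then have "(h \<circ> q) ` p ` V = carr B"
      by (simp add: image_image q)
    then show ?thesis
      using hom \<open>V \<subseteq> U\<close> by (simp add: hom_onto_def q V_op subset_iff flip: p_op)
  qed
  ultimately have "image_of_subpower A J B"
    unfolding image_of_subpower_def by (intro exI conjI)
  then show ?thesis by (auto simp: variety_generated_def)
qed

text \<open>The variables \<open>x\<^sub>1, x\<^sub>2, \<dots>\<close> are \<open>1, 2, \<dots>\<close>, and \<open>x\<close> is \<open>0\<close>. A commutative word is a
  multiset of variables; the elements of the free commutative semigroup are the nonempty ones.
  A term is a finite nonempty set of nonempty words.\<close>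

type_synonym word = "nat multiset"
type_synonym trm = "word set"

definition is_term :: "trm \<Rightarrow> bool" where
  "is_term t \<longleftrightarrow> finite t \<and> t \<noteq> {} \<and> {#} \<notin> t"

text \<open>There are no neutral elements in the signature, hence an evaluation by iterating the
  binary operations along an arbitrary enumeration of the word or term. The lemmas
  \<open>word_val_mset\<close> and \<open>term_val_set\<close> below show that the choice is immaterial.\<close>

fun fold1 :: "('a \<Rightarrow> 'a \<Rightarrow> 'a) \<Rightarrow> 'a list \<Rightarrow> 'a" where
  "fold1 f [x] = x"
| "fold1 f (x # y # zs) = f x (fold1 f (y # zs))"

definition word_val :: "'a alg \<Rightarrow> (nat \<Rightarrow> 'a) \<Rightarrow> word \<Rightarrow> 'a" where
  "word_val B \<phi> w = fold1 (mul B) (map \<phi> (SOME xs. mset xs = w))"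

definition term_val :: "'a alg \<Rightarrow> (nat \<Rightarrow> 'a) \<Rightarrow> trm \<Rightarrow> 'a" where
  "term_val B \<phi> t = fold1 (add B) (map (word_val B \<phi>) (SOME ws. set ws = t))"

type_synonym identity = "trm \<times> trm"

definition satisfies :: "'a alg \<Rightarrow> identity \<Rightarrow> bool" where
  "satisfies B e \<longleftrightarrow> (\<forall>\<phi> \<in> UNIV \<rightarrow> carr B. term_val B \<phi> (fst e) = term_val B \<phi> (snd e))"

definition ineq :: "trm \<Rightarrow> trm \<Rightarrow> identity" (infix "\<preceq>" 50) where
  "u \<preceq> v = (v, v \<union> u)"

lemma fold1_Cons: "xs \<noteq> [] \<Longrightarrow> fold1 f (x # xs) = f x (fold1 f xs)"
  by (cases xs) auto

lemma fold1_closed: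
  assumes "\<And>x y. \<lbrakk>x \<in> C; y \<in> C\<rbrakk> \<Longrightarrow> f x y \<in> C"
  shows "\<lbrakk>xs \<noteq> []; set xs \<subseteq> C\<rbrakk> \<Longrightarrow> fold1 f xs \<in> C"
  proof (induction xs)
  case (Cons x xs)
  then show ?case by (cases "xs = []") (auto simp: fold1_Cons assms)
qed simp

lemma fold1_remove1:
  assumes closed: "\<And>x y. \<lbrakk>x \<in> C; y \<in> C\<rbrakk> \<Longrightarrow> f x y \<in> C"
    and assoc: "\<And>x y z. \<lbrakk>x \<in> C; y \<in> C; z \<in> C\<rbrakk> \<Longrightarrow> f (f x y) z = f x (f y z)"
    and comm: "\<And>x y. \<lbrakk>x \<in> C; y \<in> C\<rbrakk> \<Longrightarrow> f x y = f y x"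
  shows "\<lbrakk>set xs \<subseteq> C; x \<in> set xs; remove1 x xs \<noteq> []\<rbrakk> \<Longrightarrow> fold1 f xs = f x (fold1 f (remove1 x xs))"
proof (induction xs)
  case Nil
  then show ?case by simp
next
  case (Cons y ys)
  show ?case
  proof (cases "x = y")
    case True
    then show ?thesis using Cons.prems by (simp add: fold1_Cons)
  next
    case False
    with Cons.prems have x: "x \<in> set ys" and C: "set ys \<subseteq> C" "y \<in> C" by auto
    from x have ne: "ys \<noteq> []" by auto
    show ?thesis
    proof (cases "remove1 x ys = []")
      case True
      with x have "ys = [x]"
        by (cases ys) (auto split: if_splits)
      then show ?thesis using False comm C by simp
    next
      case ne': False
      have R: "fold1 f (remove1 x ys) \<in> C"
        using C set_remove1_subset[of x ys] by (intro fold1_closed closed ne') auto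
      have xC: "x \<in> C" using x C by auto
      have "fold1 f (y # ys) = f y (f x (fold1 f (remove1 x ys)))"
        using Cons.IH[OF C(1) x ne'] ne by (simp add: fold1_Cons)
      also have "\<dots> = f x (f y (fold1 f (remove1 x ys)))"
        using assoc comm C(2) xC R by metis
      finally show ?thesis using False ne' by (simp add: fold1_Cons)
    qed
  qed
qed

lemma fold1_mset_cong:
  assumes closed: "\<And>x y. \<lbrakk>x \<in> C; y \<in> C\<rbrakk> \<Longrightarrow> f x y \<in> C"
    and assoc: "\<And>x y z. \<lbrakk>x \<in> C; y \<in> C; z \<in> C\<rbrakk> \<Longrightarrow> f (f x y) z = f x (f y z)"
    and comm: "\<And>x y. \<lbrakk>x \<in> C; y \<in> C\<rbrakk> \<Longrightarrow> f x y = f y x"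
  shows "\<lbrakk>mset xs = mset ys; set xs \<subseteq> C\<rbrakk> \<Longrightarrow> fold1 f xs = fold1 f ys"
proof (induction xs arbitrary: ys)
  case Nil
  then show ?case by simp
next
  case (Cons x xs)
  have x: "x \<in> set ys" and C: "set ys \<subseteq> C"
    using Cons.prems mset_eq_setD[OF Cons.prems(1)] by auto
  have m: "mset xs = mset (remove1 x ys)"
    using Cons.prems(1)[symmetric] by simp
  show ?case
  proof (cases "xs = []")
    case True
    then have "mset ys = {#x#}" using Cons.prems(1) by simp
    then have "ys = [x]" by simp
    then show ?thesis using True by simp
  next
    case False
    then have "remove1 x ys \<noteq> []" by (metis m mset_zero_iff)
    then have "fold1 f ys = f x (fold1 f (remove1 x ys))"
      using fold1_remove1[of C f ys x, OF closed assoc comm] C x by blast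
    then show ?thesis using Cons.IH[OF m] Cons.prems(2) False by (simp add: fold1_Cons)
  qed
qed

lemma fold1_set_cong:
  assumes closed: "\<And>x y. \<lbrakk>x \<in> C; y \<in> C\<rbrakk> \<Longrightarrow> f x y \<in> C"
    and assoc: "\<And>x y z. \<lbrakk>x \<in> C; y \<in> C; z \<in> C\<rbrakk> \<Longrightarrow> f (f x y) z = f x (f y z)"
    and comm: "\<And>x y. \<lbrakk>x \<in> C; y \<in> C\<rbrakk> \<Longrightarrow> f x y = f y x"
    and idem: "\<And>x. x \<in> C \<Longrightarrow> f x x = x"
    and "set xs = set ys" "xs \<noteq> []" "set xs \<subseteq> C"
  shows "fold1 f xs = fold1 f ys"
proof -
  have cl: "fold1 f zs \<in> C" if "zs \<noteq> []" "set zs \<subseteq> C" for zs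
    using fold1_closed[of C f] closed that by blast
  have absorb: "f x (fold1 f zs) = fold1 f zs" if "set zs \<subseteq> C" "x \<in> set zs" for x zs
    using that
  proof (induction zs)
    case (Cons z zs)
    show ?case
    proof (cases "zs = []")
      case True
      then show ?thesis using Cons.prems idem by auto
    next
      case False
      have C: "x \<in> C" "z \<in> C" "fold1 f zs \<in> C" using Cons.prems cl[OF False] by auto
      show ?thesis
      proof (cases "x = z")
        case True
        then show ?thesis
          using C assoc[of z z "fold1 f zs"] idem False by (simp add: fold1_Cons)
      next
        case False
        then have "f x (fold1 f zs) = fold1 f zs" using Cons by auto
        then have "f x (f z (fold1 f zs)) = f z (fold1 f zs)"
          using C assoc comm by metis
        then show ?thesis using \<open>zs \<noteq> []\<close> by (simp add: fold1_Cons)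
      qed
    qed
  qed simp
  have below: "f (fold1 f us) (fold1 f vs) = fold1 f vs"
    if "us \<noteq> []" "set us \<subseteq> set vs" "set vs \<subseteq> C" for us vs
    using that
  proof (induction us)
    case (Cons u us)
    have "vs \<noteq> []" using Cons.prems by auto
    then have V: "fold1 f vs \<in> C" using cl Cons.prems by blast
    have u: "f u (fold1 f vs) = fold1 f vs" using absorb Cons.prems by auto
    show ?case
    proof (cases "us = []")
      case True
      then show ?thesis using u by simp
    next
      case False
      have "fold1 f us \<in> C" "u \<in> C" using False cl[of us] Cons.prems by auto
      moreover have "f (fold1 f us) (fold1 f vs) = fold1 f vs"
        using Cons False by auto
      ultimately show ?thesis
        using False u V assoc by (simp add: fold1_Cons)
    qed
  qed simp
  have "ys \<noteq> []" using assms(5,6) by auto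
  have "fold1 f xs = f (fold1 f ys) (fold1 f xs)"
    using below[of ys xs] \<open>ys \<noteq> []\<close> assms(5,7) by auto
  also have "\<dots> = f (fold1 f xs) (fold1 f ys)"
    using comm cl[of xs] cl[of ys] \<open>ys \<noteq> []\<close> assms(5-7) by auto
  also have "\<dots> = fold1 f ys"
    using below[of xs ys] assms(5-7) by auto
  finally show ?thesis .
qed

context comm_ai_semiring
begin

lemma word_val_mset:
  assumes "\<phi> \<in> UNIV \<rightarrow> carr S"
  shows "word_val S \<phi> (mset xs) = fold1 (mul S) (map \<phi> xs)"
proof -
  have "mset (SOME ys. mset ys = mset xs) = mset xs"
    by (rule someI_ex) blast
  then have "mset (map \<phi> (SOME ys. mset ys = mset xs)) = mset (map \<phi> xs)"
    by simp
  then show ?thesis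
    unfolding word_val_def
    by (rule fold1_mset_cong[of "carr S", rotated 3])
      (use assms mul_closed mul_assoc mul_comm in auto)
qed

lemma word_val_closed:
  assumes "\<phi> \<in> UNIV \<rightarrow> carr S" "w \<noteq> {#}"
  shows "word_val S \<phi> w \<in> carr S"
proof -
  obtain xs where "mset xs = w" using ex_mset by blast
  then show ?thesis
    using assms fold1_closed[of "carr S" "mul S" "map \<phi> xs"] mul_closed
    by (auto simp flip: \<open>mset xs = w\<close> simp: word_val_mset)
qed

lemma term_val_set:
  assumes "\<phi> \<in> UNIV \<rightarrow> carr S" "is_term (set ws)"
  shows "term_val S \<phi> (set ws) = fold1 (add S) (map (word_val S \<phi>) ws)"
proof -
  have 1: "set (SOME vs. set vs = set ws) = set ws"
    by (rule someI_ex) blast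
  then have "(SOME vs. set vs = set ws) \<noteq> []"
    using assms(2) by (auto simp: is_term_def)
  moreover have "word_val S \<phi> w \<in> carr S" if "w \<in> set ws" for w
    using assms that by (intro word_val_closed) (auto simp: is_term_def)
  ultimately show ?thesis
    unfolding term_val_def
    using 1 add_closed add_assoc add_comm add_idem
    by (intro fold1_set_cong[of "carr S"]) auto
qed

end

definition cube_identity :: identity where
  "cube_identity = ({{#0, 0, 0#}}, {{#0, 0#}})"

definition q :: "nat \<Rightarrow> nat \<Rightarrow> word" where
  "q n k = (\<Sum>i\<in>{1..k}. {#i#}) + (\<Sum>i\<in>{k+1..n+1}. {#i, i#})"

text \<open>The families \<open>w\<close>, \<open>w'\<close>, \<open>ww\<close> are total functions, of which only the values at the indices
  occurring in the respective sum matter. A single family \<open>w\<close> serves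
  both the summands \<open>x\<^sub>i w\<^sub>i\<close> with \<open>i \<le> k\<close> and the summands \<open>x\<^sub>i\<^sup>2 w\<^sub>i\<close> with \<open>i > k\<close>.\<close>

definition square_ineqs :: "identity set" where
  "square_ineqs =
    {{\<Sum>i\<in>{1..n+1}. {#i, i#}} \<preceq> {{#i, i#} + w i | i. i \<in> {1..n+1}}
     | n w. n \<ge> 1 \<and> (\<forall>i\<in>{1..n+1}. set_mset (w i) \<subseteq> {1..n+1} - {i})}"

definition linear_ineqs :: "identity set" where
  "linear_ineqs =
    {{q n k} \<preceq>
       {{#i#} + w i | i. i \<in> {1..k}} \<union>
       {{#i, i#} + w' i | i. i \<in> {1..<k}} \<union>
       {{#i, i#} + w i | i. i \<in> {k+1..n+1}}
     | n k w w'. n \<ge> 1 \<and> 1 \<le> k \<and> k \<le> n + 1 \<and>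
         (\<forall>i\<in>{1..n+1}. set_mset (w i) \<subseteq> {1..n+1} - {i}) \<and>
         (\<forall>i\<in>{1..<k}. set_mset (w' i) \<subseteq> {1..n+1} - {i})}"

definition pair_ineqs :: "identity set" where
  "pair_ineqs =
    {{q n k} \<preceq>
       {{#i#} + w i | i. i \<in> {1..k}} \<union>
       {{#i, i#} + w' i | i. i \<in> {1..l}} \<union>
       {{#i, j#} + ww i j | i j. l + 1 \<le> i \<and> i < j \<and> j \<le> k} \<union>
       {{#i, i#} + w i | i. i \<in> {k+1..n+1}}
     | n k l w w' ww. n \<ge> 1 \<and> 1 \<le> k \<and> k \<le> n + 1 \<and> l + 1 < k \<and>
         (\<forall>i\<in>{1..n+1}. set_mset (w i) \<subseteq> {1..n+1} - {i}) \<and>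
         (\<forall>i\<in>{1..l}. set_mset (w' i) \<subseteq> {1..n+1} - {i}) \<and>
         (\<forall>i j. l + 1 \<le> i \<and> i < j \<and> j \<le> k \<longrightarrow> set_mset (ww i j) \<subseteq> {1..n+1} - {i, j})}"

end

theory Submission
  imports Defs
begin

text \<open>Whether \<open>u \<preceq> V\<close> holds in the power semiring is decided element by element. An element of
  the value of \<open>u\<close> arises by choosing an element of \<open>S7\<close> for every letter of \<open>u\<close>, and the critical
  choices are: one letter is \<open>A7\<close> and the others are \<open>One7\<close> (product \<open>A7\<close>), or two letters are \<open>A7\<close>
  (product \<open>0\<close>), while variables outside \<open>u\<close> are sent to the empty set. This gives a
  combinatorial criterion (\<open>covered\<close>): among the words of \<open>V\<close> with content inside that of \<open>u\<close>, every
  linear variable of \<open>u\<close> is linear in some word, every nonlinear one is nonlinear in some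
  word, and for every two linear variables some word has one of them squared or both of them.

  Conversely, let \<open>u\<close> be covered by \<open>V\<close>, and let \<open>l\<close> of its \<open>k\<close> linear variables occur squared in a suitable word
  of \<open>V\<close>. After numbering those first, the other linear ones next and the nonlinear ones last, and after truncating
  exponents by \<open>x\<^sup>3 = x\<^sup>2\<close>, the inequality is an instance of (2) if \<open>k = 0\<close>, of (3) if \<open>l \<ge> k - 1\<close>, and
  of (4) otherwise. Birkhoff's theorem then places every model in the variety.\<close>

section \<open>Values of words and terms\<close>

text \<open>The variables range over an arbitrary type: the free algebra built at the end has the
  elements of another algebra as its variables, whereas \<open>word_val\<close> is tied to
  \<open>nat\<close>.\<close>

definition wval :: "'a alg \<Rightarrow> ('x \<Rightarrow> 'a) \<Rightarrow> 'x multiset \<Rightarrow> 'a" where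
  "wval S \<phi> w = fold1 (mul S) (map \<phi> (SOME xs. mset xs = w))"

text \<open>A term is a list of words here, so that sums of terms are concatenations and no
  enumeration of the term has to be chosen.\<close>

definition tval :: "'a alg \<Rightarrow> ('x \<Rightarrow> 'a) \<Rightarrow> 'x multiset list \<Rightarrow> 'a" where
  "tval S \<phi> t = fold1 (add S) (map (wval S \<phi>) t)"

text \<open>The product of two sums of words, multiplied out by distributivity.\<close>

definition tmul :: "'x multiset list \<Rightarrow> 'x multiset list \<Rightarrow> 'x multiset list" where
  "tmul t u = concat (map (\<lambda>w. map ((+) w) u) t)"

lemma tmul_term:
  assumes "t \<noteq> []" "{#} \<notin> set t" "u \<noteq> []" "{#} \<notin> set u"
  shows "tmul t u \<noteq> []" "{#} \<notin> set (tmul t u)"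
  using assms by (auto simp: tmul_def neq_Nil_conv)

text \<open>The order of the semilattice formed by addition, in which a sum is the join of its
  summands.\<close>

definition below :: "'a alg \<Rightarrow> 'a \<Rightarrow> 'a \<Rightarrow> bool" where
  "below S x y \<longleftrightarrow> add S y x = y"

lemma word_val_eq_wval: "word_val S \<phi> w = wval S \<phi> w"
  by (simp add: word_val_def wval_def)

lemma fold1_append:
  assumes closed: "\<And>x y. \<lbrakk>x \<in> C; y \<in> C\<rbrakk> \<Longrightarrow> f x y \<in> C"
    and assoc: "\<And>x y z. \<lbrakk>x \<in> C; y \<in> C; z \<in> C\<rbrakk> \<Longrightarrow> f (f x y) z = f x (f y z)"
  shows "\<lbrakk>xs \<noteq> []; ys \<noteq> []; set xs \<subseteq> C; set ys \<subseteq> C\<rbrakk> \<Longrightarrow> fold1 f (xs @ ys) = f (fold1 f xs) (fold1 f ys)"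
proof (induction xs)
  case (Cons x xs)
  have "fold1 f ys \<in> C" using fold1_closed[of C f ys] closed Cons.prems by blast
  moreover have "fold1 f xs \<in> C" if "xs \<noteq> []" using fold1_closed[of C f xs] closed Cons.prems that by auto
  ultimately show ?case using Cons assoc by (cases "xs = []") (auto simp: fold1_Cons)
qed simp

lemma fold1_hom:
  assumes closed: "\<And>x y. \<lbrakk>x \<in> C; y \<in> C\<rbrakk> \<Longrightarrow> f x y \<in> C"
    and hom: "\<And>x y. \<lbrakk>x \<in> C; y \<in> C\<rbrakk> \<Longrightarrow> h (f x y) = g (h x) (h y)"
  shows "\<lbrakk>xs \<noteq> []; set xs \<subseteq> C\<rbrakk> \<Longrightarrow> fold1 g (map h xs) = h (fold1 f xs)"
proof (induction xs)
  case (Cons x xs)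
  then show ?case using fold1_closed[of C f xs] closed hom
    by (cases "xs = []") (auto simp: fold1_Cons)
qed simp

section \<open>Evaluation in a commutative ai-semiring\<close>

context comm_ai_semiring
begin

lemma wval_mset:
  assumes "\<phi> \<in> UNIV \<rightarrow> carr S"
  shows "wval S \<phi> (mset xs) = fold1 (mul S) (map \<phi> xs)"
proof -
  have "mset (SOME ys. mset ys = mset xs) = mset xs"
    by (rule someI_ex) blast
  then have "mset (map \<phi> (SOME ys. mset ys = mset xs)) = mset (map \<phi> xs)"
    by simp
  then show ?thesis
    unfolding wval_def
    by (rule fold1_mset_cong[of "carr S", rotated 3])
      (use assms mul_closed mul_assoc mul_comm in auto)
qed

lemma wval_closed:
  assumes "\<phi> \<in> UNIV \<rightarrow> carr S" "w \<noteq> {#}"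
  shows "wval S \<phi> w \<in> carr S"
proof -
  obtain xs where "mset xs = w" using ex_mset by blast
  then show ?thesis
    using assms fold1_closed[of "carr S" "mul S" "map \<phi> xs"] mul_closed
    by (auto simp flip: \<open>mset xs = w\<close> simp: wval_mset)
qed

lemma wval_single:
  assumes "\<phi> \<in> UNIV \<rightarrow> carr S"
  shows "wval S \<phi> {#x#} = \<phi> x"
  using wval_mset[OF assms, of "[x]"] by simp

lemma wval_set_closed:
  assumes "\<phi> \<in> UNIV \<rightarrow> carr S" "{#} \<notin> set t"
  shows "set (map (wval S \<phi>) t) \<subseteq> carr S"
proof -
  have "wval S \<phi> w \<in> carr S" if "w \<in> set t" for w
    using assms that by (intro wval_closed) auto
  then show ?thesis by auto
qed

lemma wval_plus:
  assumes "\<phi> \<in> UNIV \<rightarrow> carr S" "u \<noteq> {#}" "v \<noteq> {#}"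
  shows "wval S \<phi> (u + v) = wval S \<phi> u \<otimes> wval S \<phi> v"
proof -
  obtain xs ys where "mset xs = u" "mset ys = v" using ex_mset by metis
  moreover have "fold1 (mul S) (map \<phi> xs @ map \<phi> ys) = fold1 (mul S) (map \<phi> xs) \<otimes> fold1 (mul S) (map \<phi> ys)"
    using assms calculation mul_closed mul_assoc by (intro fold1_append[of "carr S"]) auto
  moreover have "wval S \<phi> (mset xs + mset ys) = fold1 (mul S) (map \<phi> xs @ map \<phi> ys)"
    using wval_mset[OF assms(1), of "xs @ ys"] by simp
  ultimately show ?thesis using assms(1) by (metis wval_mset)
qed

lemma wval_image_mset:
  assumes "\<phi> \<in> UNIV \<rightarrow> carr S"
  shows "wval S \<phi> (image_mset \<sigma> w) = wval S (\<phi> \<circ> \<sigma>) w"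
proof -
  obtain xs where "mset xs = w" using ex_mset by blast
  then show ?thesis
    using wval_mset[of \<phi> "map \<sigma> xs"] wval_mset[of "\<phi> \<circ> \<sigma>" xs] assms by (auto simp: Pi_iff)
qed

section \<open>The semilattice order\<close>

lemma below_refl: "x \<in> carr S \<Longrightarrow> below S x x"
  by (simp add: below_def add_idem)

lemma below_trans:
  "\<lbrakk>below S x y; below S y z; x \<in> carr S; y \<in> carr S; z \<in> carr S\<rbrakk> \<Longrightarrow> below S x z"
  unfolding below_def by (metis add_assoc)

lemma below_antisym:
  "\<lbrakk>below S x y; below S y x; x \<in> carr S; y \<in> carr S\<rbrakk> \<Longrightarrow> x = y"
  unfolding below_def by (metis add_comm)

lemma below_add_iff:
  assumes "x \<in> carr S" "y \<in> carr S" "z \<in> carr S"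
  shows "below S (x \<oplus> y) z \<longleftrightarrow> below S x z \<and> below S y z"
  unfolding below_def using assms by (metis add_assoc add_comm add_idem add_closed)

lemma below_fold1_iff:
  "\<lbrakk>xs \<noteq> []; set xs \<subseteq> carr S; z \<in> carr S\<rbrakk> \<Longrightarrow> below S (fold1 (add S) xs) z \<longleftrightarrow> (\<forall>x\<in>set xs. below S x z)"
proof (induction xs)
  case (Cons x xs)
  then show ?case using fold1_closed[of "carr S" "add S" xs] add_closed
    by (cases "xs = []") (auto simp: fold1_Cons below_add_iff)
qed simp

lemma tval_closed:
  assumes "\<phi> \<in> UNIV \<rightarrow> carr S" "t \<noteq> []" "{#} \<notin> set t"
  shows "tval S \<phi> t \<in> carr S"
  unfolding tval_def
  using fold1_closed[of "carr S" "add S", OF add_closed _ wval_set_closed[OF assms(1,3)]] assms(2) by simp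

lemma tval_below_iff:
  assumes "\<phi> \<in> UNIV \<rightarrow> carr S" "t \<noteq> []" "{#} \<notin> set t" "z \<in> carr S"
  shows "below S (tval S \<phi> t) z \<longleftrightarrow> (\<forall>w\<in>set t. below S (wval S \<phi> w) z)"
proof -
  have "set (map (wval S \<phi>) t) \<subseteq> carr S" using assms by (intro wval_set_closed)
  then show ?thesis unfolding tval_def using assms by (subst below_fold1_iff) auto
qed

lemma tval_append:
  assumes "\<phi> \<in> UNIV \<rightarrow> carr S" "t \<noteq> []" "{#} \<notin> set t" "u \<noteq> []" "{#} \<notin> set u"
  shows "tval S \<phi> (t @ u) = tval S \<phi> t \<oplus> tval S \<phi> u"
proof -
  have "set (map (wval S \<phi>) t) \<subseteq> carr S" "set (map (wval S \<phi>) u) \<subseteq> carr S"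
    using assms by (intro wval_set_closed; simp)+
  then show ?thesis unfolding tval_def map_append
    using assms by (intro fold1_append[of "carr S"] add_closed add_assoc) auto
qed

lemma tval_Cons:
  assumes "\<phi> \<in> UNIV \<rightarrow> carr S" "t \<noteq> []"
  shows "tval S \<phi> (w # t) = wval S \<phi> w \<oplus> tval S \<phi> t"
  using assms by (simp add: tval_def fold1_Cons)

lemma tval_map_plus:
  assumes "\<phi> \<in> UNIV \<rightarrow> carr S" "w \<noteq> {#}"
  shows "\<lbrakk>t \<noteq> []; {#} \<notin> set t\<rbrakk> \<Longrightarrow> tval S \<phi> (map ((+) w) t) = wval S \<phi> w \<otimes> tval S \<phi> t"
proof (induction t)
  case (Cons v t)
  show ?case
  proof (cases "t = []")
    case True
    then show ?thesis using Cons.prems assms by (simp add: tval_def wval_plus)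
  next
    case False
    then show ?thesis
      using Cons assms by (auto simp: tval_Cons wval_plus distrib_left wval_closed tval_closed)
  qed
qed simp

lemma tval_tmul:
  assumes "\<phi> \<in> UNIV \<rightarrow> carr S" "u \<noteq> []" "{#} \<notin> set u"
  shows "\<lbrakk>t \<noteq> []; {#} \<notin> set t\<rbrakk> \<Longrightarrow> tval S \<phi> (tmul t u) = tval S \<phi> t \<otimes> tval S \<phi> u"
proof (induction t)
  case (Cons w t)
  have w: "tval S \<phi> (map ((+) w) u) = wval S \<phi> w \<otimes> tval S \<phi> u"
    using Cons.prems assms by (intro tval_map_plus) auto
  show ?case
  proof (cases "t = []")
    case True
    then show ?thesis using w by (simp add: tval_def tmul_def)
  next
    case False
    have "tmul (w # t) u = map ((+) w) u @ tmul t u" by (simp add: tmul_def)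
    moreover have "tval S \<phi> (map ((+) w) u @ tmul t u) = tval S \<phi> (map ((+) w) u) \<oplus> tval S \<phi> (tmul t u)"
      using Cons.prems assms False by (intro tval_append tmul_term) auto
    ultimately show ?thesis
      using Cons assms False w by (auto simp: tval_Cons distrib_right wval_closed tval_closed)
  qed
qed simp

lemma term_val_eq_tval:
  assumes "\<phi> \<in> UNIV \<rightarrow> carr S" "is_term (set t)"
  shows "term_val S \<phi> (set t) = tval S \<phi> t"
  using term_val_set[OF assms] by (simp add: tval_def word_val_eq_wval[abs_def])

text \<open>In a join semilattice, lying below a join means lying below every upper bound of its
  members. In this form the words of \<open>v\<close> are treated one at a time, against a fixed
  bound \<open>z\<close>.\<close>

lemma satisfies_ineq_iff:
  assumes "u \<noteq> {#}" "is_term v"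
  shows "satisfies S ({u} \<preceq> v) \<longleftrightarrow> (\<forall>\<phi>\<in>UNIV \<rightarrow> carr S. \<forall>z\<in>carr S.
           (\<forall>w\<in>v. below S (wval S \<phi> w) z) \<longrightarrow> below S (wval S \<phi> u) z)"
proof -
  obtain t where t: "set t = v" using assms(2) finite_list by (auto simp: is_term_def)
  then have tt: "t \<noteq> []" "{#} \<notin> set t" using assms(2) by (auto simp: is_term_def)
  have "term_val S \<phi> v = term_val S \<phi> (v \<union> {u}) \<longleftrightarrow>
     (\<forall>z\<in>carr S. (\<forall>w\<in>v. below S (wval S \<phi> w) z) \<longrightarrow> below S (wval S \<phi> u) z)"
    if \<phi>: "\<phi> \<in> UNIV \<rightarrow> carr S" for \<phi>
  proof -
    have "term_val S \<phi> v = tval S \<phi> t"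
      using term_val_eq_tval[OF \<phi>] t assms(2) by blast
    moreover have "term_val S \<phi> (v \<union> {u}) = tval S \<phi> (t @ [u])"
      using term_val_eq_tval[OF \<phi>, of "t @ [u]"] t assms by (auto simp: is_term_def)
    moreover have "tval S \<phi> (t @ [u]) = tval S \<phi> t \<oplus> wval S \<phi> u"
      using tval_append[OF \<phi> tt, of "[u]"] assms by (simp add: tval_def)
    ultimately have "term_val S \<phi> v = term_val S \<phi> (v \<union> {u}) \<longleftrightarrow> below S (wval S \<phi> u) (tval S \<phi> t)"
      by (auto simp: below_def)
    also have "\<dots> \<longleftrightarrow> (\<forall>z\<in>carr S. below S (tval S \<phi> t) z \<longrightarrow> below S (wval S \<phi> u) z)"
      using \<phi> tt tval_closed wval_closed below_trans below_refl assms(1) by metis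
    finally show ?thesis using tval_below_iff[OF \<phi> tt] t by simp
  qed
  then show ?thesis by (simp add: satisfies_def ineq_def)
qed

end

section \<open>Inequalities of the power semiring\<close>

text \<open>The clauses belong to the products that need a particular word: \<open>A7\<close> from
  one linear letter, \<open>0\<close> from a repeated letter, and \<open>0\<close> from two distinct
  linear letters. The product \<open>1\<close> needs just some word with content inside that of
  \<open>u\<close>, which the first two clauses supply when \<open>u\<close> is nonempty.\<close>

definition covered :: "'x multiset \<Rightarrow> 'x multiset set \<Rightarrow> bool" where
  "covered u V \<longleftrightarrow>
    (\<forall>x. count u x = 1 \<longrightarrow> (\<exists>w\<in>V. set_mset w \<subseteq> set_mset u \<and> count w x = 1)) \<and>
    (\<forall>x. count u x \<ge> 2 \<longrightarrow> (\<exists>w\<in>V. set_mset w \<subseteq> set_mset u \<and> count w x \<ge> 2)) \<and>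
    (\<forall>x y. x \<noteq> y \<and> count u x = 1 \<and> count u y = 1 \<longrightarrow>
      (\<exists>w\<in>V. set_mset w \<subseteq> set_mset u \<and> (count w x \<ge> 2 \<or> count w y \<ge> 2 \<or> (x \<in># w \<and> y \<in># w))))"

lemma
  assumes "covered u V"
  shows covered_linear: "count u x = 1 \<Longrightarrow> \<exists>w\<in>V. set_mset w \<subseteq> set_mset u \<and> count w x = 1"
    and covered_square: "count u x \<ge> 2 \<Longrightarrow> \<exists>w\<in>V. set_mset w \<subseteq> set_mset u \<and> count w x \<ge> 2"
    and covered_pair: "\<lbrakk>count u x = 1; count u y = 1; x \<noteq> y\<rbrakk> \<Longrightarrow>
      \<exists>w\<in>V. set_mset w \<subseteq> set_mset u \<and> (count w x \<ge> 2 \<or> count w y \<ge> 2 \<or> (x \<in># w \<and> y \<in># w))"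
  using assms by (simp_all add: covered_def)

section \<open>Membership in products of subsets of \<open>S7\<close>\<close>

lemma One7_in_prod: "One7 \<in> (\<Prod>x\<in>#w. \<phi> x) \<longleftrightarrow> (\<forall>x\<in>#w. One7 \<in> \<phi> x)"
proof (induction w)
  case empty
  then show ?case by (simp add: one_S7_def set_one)
next
  case (add x w)
  have "One7 = p * r \<longleftrightarrow> p = One7 \<and> r = One7" for p r by (cases p; cases r) auto
  then show ?case using add by (auto simp: set_times_def)
qed

lemma prod_nonempty: "(\<Prod>x\<in>#w. \<phi> x) \<noteq> ({} :: S7 set) \<longleftrightarrow> (\<forall>x\<in>#w. \<phi> x \<noteq> {})"
proof (induction w)
  case (add x w)
  have "A * B \<noteq> {} \<longleftrightarrow> A \<noteq> {} \<and> B \<noteq> {}" for A B :: "S7 set"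
    by (auto simp: set_times_def)
  then show ?case using add by simp
qed simp

text \<open>In \<open>S7\<close> a product is \<open>A7\<close> only if exactly one factor is
  \<open>A7\<close> and all others are \<open>1\<close>. Only one copy of \<open>x\<close> is
  removed, so a repeated \<open>x\<close> has to offer \<open>One7\<close> as well.\<close>

lemma A7_in_prod:
  "A7 \<in> (\<Prod>x\<in>#w. \<phi> x) \<longleftrightarrow> (\<exists>x\<in>#w. A7 \<in> \<phi> x \<and> (\<forall>y\<in>#w - {#x#}. One7 \<in> \<phi> y))"
proof
  show "A7 \<in> (\<Prod>x\<in>#w. \<phi> x) \<Longrightarrow> \<exists>x\<in>#w. A7 \<in> \<phi> x \<and> (\<forall>y\<in>#w - {#x#}. One7 \<in> \<phi> y)"
  proof (induction w)
    case empty
    then show ?case by (simp add: one_S7_def set_one)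
  next
    case (add x w)
    have "A7 = p * r \<longleftrightarrow> p = One7 \<and> r = A7 \<or> p = A7 \<and> r = One7" for p r by (cases p; cases r) auto
    then consider "One7 \<in> \<phi> x" "A7 \<in> (\<Prod>x\<in>#w. \<phi> x)" | "A7 \<in> \<phi> x" "One7 \<in> (\<Prod>x\<in>#w. \<phi> x)"
      using add.prems by (auto simp: set_times_def)
    then show ?case
    proof cases
      case 1
      then obtain y where "y \<in># w" "A7 \<in> \<phi> y" "\<forall>z\<in>#w - {#y#}. One7 \<in> \<phi> z" using add.IH by blast
      then show ?thesis using 1 by (intro bexI[of _ y]) (auto dest: in_diffD split: if_splits)
    next
      case 2
      then show ?thesis by (auto simp: One7_in_prod)
    qed
  qed
next
  assume "\<exists>x\<in>#w. A7 \<in> \<phi> x \<and> (\<forall>y\<in>#w - {#x#}. One7 \<in> \<phi> y)"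
  then obtain x u where w: "w = add_mset x u" and "A7 \<in> \<phi> x" "\<forall>y\<in>#u. One7 \<in> \<phi> y"
    by (metis add_mset_remove_trivial insert_DiffM)
  then have "A7 * One7 \<in> \<phi> x * (\<Prod>x\<in>#u. \<phi> x)"
    by (intro set_times_intro) (auto simp: One7_in_prod)
  then show "A7 \<in> (\<Prod>x\<in>#w. \<phi> x)" using w by simp
qed

text \<open>A product in \<open>S7\<close> is \<open>0\<close> exactly when some factor is
  \<open>0\<close> or two factors are \<open>A7\<close>. The other factors are arbitrary but must
  exist, whence the nonemptiness condition. The two letters may be the same variable occurring
  twice.\<close>

lemma Zero7_in_prod:
  "Zero7 \<in> (\<Prod>x\<in>#w. \<phi> x) \<longleftrightarrow> (\<forall>x\<in>#w. \<phi> x \<noteq> {}) \<and>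
    ((\<exists>x\<in>#w. Zero7 \<in> \<phi> x) \<or> (\<exists>x y. {#x, y#} \<subseteq># w \<and> A7 \<in> \<phi> x \<and> A7 \<in> \<phi> y))" (is "_ \<longleftrightarrow> _ \<and> ?R w")
proof
  have "Zero7 \<in> (\<Prod>x\<in>#w. \<phi> x) \<Longrightarrow> ?R w"
  proof (induction w)
    case empty
    then show ?case by (simp add: one_S7_def set_one)
  next
    case (add x w)
    have "Zero7 = p * r \<longleftrightarrow> p = Zero7 \<or> r = Zero7 \<or> p = A7 \<and> r = A7" for p r by (cases p; cases r) auto
    then consider "Zero7 \<in> \<phi> x" | "Zero7 \<in> (\<Prod>x\<in>#w. \<phi> x)" | "A7 \<in> \<phi> x" "A7 \<in> (\<Prod>x\<in>#w. \<phi> x)"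
      using add.prems by (auto simp: set_times_def)
    then show ?case
    proof cases
      case 2
      have "M \<subseteq># w \<Longrightarrow> M \<subseteq># add_mset x w" for M by (metis add_mset_add_single subset_mset.add_increasing2 subset_mset.zero_le)
      then show ?thesis using add.IH[OF 2] by auto
    next
      case 3
      then obtain y where "y \<in># w" "A7 \<in> \<phi> y" by (auto simp: A7_in_prod)
      then show ?thesis using 3 by (intro disjI2 exI[of _ x] exI[of _ y]) auto
    qed auto
  qed
  then show "Zero7 \<in> (\<Prod>x\<in>#w. \<phi> x) \<Longrightarrow> (\<forall>x\<in>#w. \<phi> x \<noteq> {}) \<and> ?R w"
    using prod_nonempty[of \<phi> w] by blast
next
  assume *: "(\<forall>x\<in>#w. \<phi> x \<noteq> {}) \<and> ?R w"
  then consider x where "x \<in># w" "Zero7 \<in> \<phi> x" | x y where "{#x, y#} \<subseteq># w" "A7 \<in> \<phi> x" "A7 \<in> \<phi> y"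
    by blast
  then show "Zero7 \<in> (\<Prod>x\<in>#w. \<phi> x)"
  proof cases
    case 1
    then obtain u where w: "w = add_mset x u" by (metis insert_DiffM)
    then obtain p where "p \<in> (\<Prod>x\<in>#u. \<phi> x)" using * prod_nonempty[of \<phi> u] by auto
    then have "Zero7 * p \<in> \<phi> x * (\<Prod>x\<in>#u. \<phi> x)" using 1 by (intro set_times_intro)
    moreover have "Zero7 * p = Zero7" by (cases p) auto
    ultimately show ?thesis using w by simp
  next
    case 2
    then obtain u where w: "w = {#x, y#} + u" by (metis subset_mset.le_iff_add)
    then obtain p where "p \<in> (\<Prod>x\<in>#u. \<phi> x)" using * prod_nonempty[of \<phi> u] by auto
    then have "A7 * (A7 * p) \<in> \<phi> x * (\<phi> y * (\<Prod>x\<in>#u. \<phi> x))" using 2 by (intro set_times_intro)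
    moreover have "A7 * (A7 * p) = Zero7" by (cases p) auto
    ultimately show ?thesis using w by simp
  qed
qed

text \<open>Trace which letters of \<open>u\<close> are responsible for the value \<open>e\<close>;
  \<open>covered\<close> provides a word of \<open>V\<close> on which suitable choices from the same
  sets give \<open>e\<close> again.\<close>

lemma covered_imp_prod_subset:
  assumes "covered u V" "u \<noteq> {#}"
  shows "(\<Prod>x\<in>#u. \<phi> x) \<subseteq> (\<Union>w\<in>V. \<Prod>x\<in>#w. \<phi> x :: S7 set)"
proof
  fix e assume e: "e \<in> (\<Prod>x\<in>#u. \<phi> x)"
  note lin = covered_linear[OF assms(1)] and sq = covered_square[OF assms(1)]
  have occ: "\<exists>w\<in>V. set_mset w \<subseteq> set_mset u \<and> x \<in># w" if "x \<in># u" for x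
  proof (cases "count u x = 1")
    case True
    then show ?thesis using lin[of x] by (metis count_eq_zero_iff zero_neq_one)
  next
    case False
    then have "count u x \<ge> 2" using that by (simp flip: count_greater_zero_iff)
    then show ?thesis using sq[of x] by (metis count_eq_zero_iff not_numeral_le_zero)
  qed
  have "\<exists>w\<in>V. e \<in> (\<Prod>x\<in>#w. \<phi> x)"
  proof (cases e)
    case One7
    then have "\<forall>x\<in>#u. One7 \<in> \<phi> x" using e by (simp add: One7_in_prod)
    moreover obtain x where "x \<in># u" using assms(2) by auto
    ultimately show ?thesis using occ[of x] One7 by (auto simp: One7_in_prod)
  next
    case A7
    then obtain x where x: "x \<in># u" "A7 \<in> \<phi> x" "\<forall>y\<in>#u - {#x#}. One7 \<in> \<phi> y"
      using e by (auto simp: A7_in_prod)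
    then have other: "One7 \<in> \<phi> y" if "y \<in># u" "y \<noteq> x" for y
      using that by (metis insert_DiffM insert_noteq_member)
    show ?thesis
    proof (cases "count u x = 1")
      case True
      then obtain w where w: "w \<in> V" "set_mset w \<subseteq> set_mset u" "count w x = 1" using lin by blast
      then have "x \<in># w" "x \<notin># w - {#x#}"
        by (simp_all add: not_in_iff flip: count_greater_zero_iff)
      then have "A7 \<in> (\<Prod>x\<in>#w. \<phi> x)"
        unfolding A7_in_prod using x other w by (metis in_diffD subsetD)
      then show ?thesis using w A7 by blast
    next
      \<comment> \<open>A repeated \<open>x\<close> offers both \<open>A7\<close> and
        \<open>One7\<close>, so any admissible word containing \<open>x\<close> will do, with
        \<open>A7\<close> at one occurrence of \<open>x\<close> and \<open>One7\<close> at all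
        others.\<close>
      case False
      then have "x \<in># u - {#x#}" using x(1) by (simp flip: count_greater_zero_iff)
      then have "One7 \<in> \<phi> x" using x(3) by blast
      moreover obtain w where w: "w \<in> V" "set_mset w \<subseteq> set_mset u" "x \<in># w" using occ x(1) by blast
      ultimately have "A7 \<in> (\<Prod>x\<in>#w. \<phi> x)"
        unfolding A7_in_prod using x other w by (metis in_diffD subsetD)
      then show ?thesis using w A7 by blast
    qed
  next
    case Zero7
    then have ne: "\<forall>x\<in>#u. \<phi> x \<noteq> {}"
      and "(\<exists>x\<in>#u. Zero7 \<in> \<phi> x) \<or> (\<exists>x y. {#x, y#} \<subseteq># u \<and> A7 \<in> \<phi> x \<and> A7 \<in> \<phi> y)"
      using e by (auto simp: Zero7_in_prod)
    \<comment> \<open>If two letters are \<open>A7\<close>, then one of them is repeated in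
      \<open>u\<close>, be they equal or not, or they are distinct and both linear.\<close>
    then consider x where "x \<in># u" "Zero7 \<in> \<phi> x" | x where "count u x \<ge> 2" "A7 \<in> \<phi> x"
      | x y where "x \<noteq> y" "count u x = 1" "count u y = 1" "A7 \<in> \<phi> x" "A7 \<in> \<phi> y"
    proof (elim disjE bexE exE conjE)
      fix x y assume "{#x, y#} \<subseteq># u" and xy: "A7 \<in> \<phi> x" "A7 \<in> \<phi> y"
      then have c: "count {#x, y#} z \<le> count u z" for z by (simp add: subseteq_mset_def)
      have "1 \<le> count {#x, y#} x" "1 \<le> count {#x, y#} y" "x = y \<Longrightarrow> 2 \<le> count {#x, y#} x"
        by simp_all
      then have "count u x \<ge> 1" "count u y \<ge> 1" "x = y \<Longrightarrow> count u x \<ge> 2"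
        using c order_trans by blast+
      then have "count u x \<ge> 2 \<or> count u y \<ge> 2 \<or> x \<noteq> y \<and> count u x = 1 \<and> count u y = 1"
        by linarith
      then show thesis using that(2,3) xy by blast
    qed auto
    then show ?thesis
    proof cases
      case 1
      then show ?thesis using occ[of x] ne Zero7 by (metis Zero7_in_prod subsetD)
    next
      case 2
      then obtain w where w: "w \<in> V" "set_mset w \<subseteq> set_mset u" "count w x \<ge> 2" using sq by blast
      then have "{#x, x#} \<subseteq># w" by (auto simp: subseteq_mset_def)
      then have "Zero7 \<in> (\<Prod>x\<in>#w. \<phi> x)" unfolding Zero7_in_prod using ne w(2) 2(2) by blast
      then show ?thesis using w(1) Zero7 by blast
    next
      case 3
      then obtain w where w: "w \<in> V" "set_mset w \<subseteq> set_mset u"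
        "count w x \<ge> 2 \<or> count w y \<ge> 2 \<or> (x \<in># w \<and> y \<in># w)"
        using covered_pair[OF assms(1) 3(2,3,1)] by blast
      then have "{#x, x#} \<subseteq># w \<or> {#y, y#} \<subseteq># w \<or> {#x, y#} \<subseteq># w"
        using 3(1) by (auto simp: subseteq_mset_def Suc_le_eq)
      then have "Zero7 \<in> (\<Prod>x\<in>#w. \<phi> x)" unfolding Zero7_in_prod using ne w(2) 3(4,5) by blast
      then show ?thesis using w(1) Zero7 by blast
    qed
  qed
  then show "e \<in> (\<Union>w\<in>V. \<Prod>x\<in>#w. \<phi> x)" by blast
qed

lemma prod_subset_imp_covered:
  assumes "\<And>\<phi>. (\<Prod>x\<in>#u. \<phi> x) \<subseteq> (\<Union>w\<in>V. \<Prod>x\<in>#w. \<phi> x :: S7 set)"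
  shows "covered u V"
proof -
  \<comment> \<open>The letters in \<open>A\<close> are sent to \<open>A7\<close>. For
    \<open>A\<close> inside the content of \<open>u\<close>, a letter foreign to \<open>u\<close>
    gets the empty set, so a word containing one has the empty product.\<close>
  define \<psi> where "\<psi> A = (\<lambda>x. if x \<in> A then {A7} else if x \<in># u then {One7} else {})" for A
  have sub: "set_mset w \<subseteq> set_mset u" if "e \<in> (\<Prod>x\<in>#w. \<psi> A x)" "A \<subseteq> set_mset u" for e w A
    using that prod_nonempty[of "\<psi> A" w] unfolding \<psi>_def by (fastforce split: if_splits)
  have zero: "\<exists>w\<in>V. set_mset w \<subseteq> set_mset u \<and> (\<exists>x y. {#x, y#} \<subseteq># w \<and> x \<in> A \<and> y \<in> A)"
    if xy: "{#x, y#} \<subseteq># u" "x \<in> A" "y \<in> A" and "A \<subseteq> set_mset u" for A x y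
  proof -
    have "Zero7 \<in> (\<Prod>x\<in>#u. \<psi> A x)"
      unfolding Zero7_in_prod using xy by (auto simp: \<psi>_def)
    then obtain w where w: "w \<in> V" "Zero7 \<in> (\<Prod>x\<in>#w. \<psi> A x)" using assms[of "\<psi> A"] by auto
    then have "\<exists>x y. {#x, y#} \<subseteq># w \<and> x \<in> A \<and> y \<in> A"
      unfolding Zero7_in_prod by (auto simp: \<psi>_def split: if_splits)
    then show ?thesis using w sub \<open>A \<subseteq> set_mset u\<close> by blast
  qed
  show ?thesis
    unfolding covered_def
  proof (intro conjI allI impI)
    fix x assume x: "count u x = 1"
    then have "x \<in># u" "x \<notin># u - {#x#}" by (auto simp: not_in_iff count_greater_zero_iff[symmetric] simp del: count_greater_zero_iff)
    moreover have "One7 \<in> \<psi> {x} y" if "y \<in># u - {#x#}" for y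
      using that in_diffD[OF that] \<open>x \<notin># u - {#x#}\<close> by (auto simp: \<psi>_def)
    ultimately have "A7 \<in> (\<Prod>y\<in>#u. \<psi> {x} y)"
      unfolding A7_in_prod by (intro bexI[of _ x]) (auto simp: \<psi>_def)
    then obtain w where w: "w \<in> V" "A7 \<in> (\<Prod>y\<in>#w. \<psi> {x} y)" using assms[of "\<psi> {x}"] by auto
    \<comment> \<open>Only \<open>x\<close> can supply the factor \<open>A7\<close>, and its set
      lacks \<open>One7\<close>, so a second occurrence of \<open>x\<close> would exclude the
      product \<open>A7\<close>.\<close>
    then have "x \<in># w" "x \<notin># w - {#x#}"
      unfolding A7_in_prod by (auto simp: \<psi>_def split: if_splits)
    then have "count w x = 1" by (metis add_mset_remove_trivial_If count_add_mset insert_DiffM not_in_iff One_nat_def)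
    then show "\<exists>w\<in>V. set_mset w \<subseteq> set_mset u \<and> count w x = 1"
      using w sub[OF w(2)] \<open>x \<in># u\<close> by auto
  next
    fix x assume x: "count u x \<ge> 2"
    then have "{#x, x#} \<subseteq># u" by (auto simp: subseteq_mset_def)
    moreover have "x \<in># u" using x by (simp flip: count_greater_zero_iff)
    ultimately obtain w where w: "w \<in> V" "set_mset w \<subseteq> set_mset u" "{#x, x#} \<subseteq># w"
      using zero[of x x "{x}"] by auto
    have "count w x \<ge> 2"
      using mset_subset_eq_count[OF w(3), of x] by simp
    then show "\<exists>w\<in>V. set_mset w \<subseteq> set_mset u \<and> count w x \<ge> 2"
      using w by blast
  next
    fix x y assume xy: "x \<noteq> y \<and> count u x = 1 \<and> count u y = 1"
    then have mem: "x \<in># u" "y \<in># u" by (simp_all flip: count_greater_zero_iff)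
    then have "{#x, y#} \<subseteq># u" using xy by (auto simp: subseteq_mset_def Suc_le_eq)
    \<comment> \<open>The two letters of \<open>w\<close> sent to \<open>A7\<close> lie in
      \<open>{x, y}\<close>: if they coincide, \<open>w\<close> contains a square, and otherwise it
      contains both \<open>x\<close> and \<open>y\<close>.\<close>
    with mem obtain w s t where w: "w \<in> V" "set_mset w \<subseteq> set_mset u" "{#s, t#} \<subseteq># w" "s \<in> {x, y}" "t \<in> {x, y}"
      using zero[of x y "{x, y}"] by auto
    have "count {#s, t#} z \<le> count w z" for z using w(3) by (simp add: subseteq_mset_def)
    from this[of s] this[of t] have "count w x \<ge> 2 \<or> count w y \<ge> 2 \<or> (x \<in># w \<and> y \<in># w)"
      using w(4,5) xy by (auto simp: Suc_le_eq split: if_splits)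
    then show "\<exists>w\<in>V. set_mset w \<subseteq> set_mset u \<and> (count w x \<ge> 2 \<or> count w y \<ge> 2 \<or> (x \<in># w \<and> y \<in># w))"
      using w by blast
  qed
qed

interpretation P7: comm_ai_semiring "power_semiring :: S7 set alg"
  by (rule comm_ai_semiring_power_semiring)

text \<open>The subsets form a commutative monoid with unit \<open>{1}\<close>, so values turn into
  \<open>prod_mset\<close>. The empty word must be excluded, as the signature has no unit to serve
  as its value.\<close>

lemma wval_power_semiring:
  assumes "w \<noteq> {#}"
  shows "wval (power_semiring :: S7 set alg) \<phi> w = (\<Prod>x\<in>#w. \<phi> x)"
proof -
  obtain xs where xs: "mset xs = w" using ex_mset by blast
  have "fold1 (mul power_semiring) ys = prod_list ys" if "ys \<noteq> []" for ys :: "S7 set list"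
    using that by (induction ys rule: induct_list012) (simp_all add: power_semiring_def del: set_one)
  moreover have "wval power_semiring \<phi> (mset xs) = fold1 (mul power_semiring) (map \<phi> xs)"
    by (rule P7.wval_mset) (simp add: power_semiring_def)
  moreover have "map \<phi> xs \<noteq> []" using xs assms by auto
  ultimately have "wval power_semiring \<phi> (mset xs) = prod_list (map \<phi> xs)" by metis
  also have "\<dots> = (\<Prod>x\<in>#mset xs. \<phi> x)" by (simp flip: prod_mset_prod_list)
  finally show ?thesis using xs by simp
qed

lemma below_power_semiring: "below power_semiring A B \<longleftrightarrow> A \<subseteq> B"
  by (auto simp: below_def power_semiring_def)

lemma power_semiring_satisfies:
  assumes "covered u v" "u \<noteq> {#}" "is_term v"
  shows "satisfies (power_semiring :: S7 set alg) ({u} \<preceq> v)"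
  unfolding P7.satisfies_ineq_iff[OF assms(2,3)] below_power_semiring
proof (intro ballI impI)
  fix \<phi> :: "nat \<Rightarrow> S7 set" and z
  assume "\<forall>w\<in>v. wval power_semiring \<phi> w \<subseteq> z"
  moreover have "wval power_semiring \<phi> w = (\<Prod>x\<in>#w. \<phi> x)" if "w \<in> v" for w
    using assms(3) that by (intro wval_power_semiring) (auto simp: is_term_def)
  ultimately show "wval power_semiring \<phi> u \<subseteq> z"
    using covered_imp_prod_subset[OF assms(1,2), of \<phi>] wval_power_semiring[OF assms(2)] by fastforce
qed

section \<open>The inequalities (2) to (4)\<close>

lemma count_q: "count (q n k) i = (if i \<in> {1..k} then 1 else 0) + (if i \<in> {k+1..n+1} then 2 else 0)"
proof -
  have "(\<Sum>j\<in>A. count {#j#} i) = (if i \<in> A then 1 else 0)"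
    "(\<Sum>j\<in>A. count {#j, j#} i) = (if i \<in> A then 2 else 0)" if "finite A" for A
    using that by (induction A rule: finite_induct) auto
  then show ?thesis by (simp only: q_def count_union count_sum finite_atLeastAtMost)
qed

lemma set_mset_q: "k \<le> n + 1 \<Longrightarrow> set_mset (q n k) = {1..n+1}"
  unfolding set_mset_def by (auto simp: count_q)

text \<open>The pair clause is symmetric in its two variables, so it suffices to check
  \<open>i < j\<close>, the form in which \<open>pair_ineqs\<close> lists its words.\<close>

lemma covered_q:
  assumes k: "k \<le> n + 1"
    and lin: "\<And>i. i \<in> {1..k} \<Longrightarrow> \<exists>w\<in>V. set_mset w \<subseteq> {1..n+1} \<and> count w i = 1"
    and sq: "\<And>i. i \<in> {k+1..n+1} \<Longrightarrow> \<exists>w\<in>V. set_mset w \<subseteq> {1..n+1} \<and> count w i \<ge> 2"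
    and pair: "\<And>i j. \<lbrakk>1 \<le> i; i < j; j \<le> k\<rbrakk> \<Longrightarrow> \<exists>w\<in>V. set_mset w \<subseteq> {1..n+1} \<and>
      (count w i \<ge> 2 \<or> count w j \<ge> 2 \<or> (i \<in># w \<and> j \<in># w))"
  shows "covered (q n k) V"
proof -
  have 1: "count (q n k) i = 1 \<longleftrightarrow> i \<in> {1..k}" and 2: "2 \<le> count (q n k) i \<longleftrightarrow> i \<in> {k+1..n+1}" for i
    by (auto simp: count_q)
  have "\<exists>w\<in>V. set_mset w \<subseteq> {1..n+1} \<and> (count w i \<ge> 2 \<or> count w j \<ge> 2 \<or> (i \<in># w \<and> j \<in># w))"
    if "i \<noteq> j" "i \<in> {1..k}" "j \<in> {1..k}" for i j
  proof -
    consider "i < j" | "j < i" using \<open>i \<noteq> j\<close> by linarith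
    then show ?thesis
    proof cases
      case 1
      then show ?thesis using pair[of i j] that by simp
    next
      case 2
      then show ?thesis using pair[of j i] that by (simp add: disj_ac conj_commute)
    qed
  qed
  then show ?thesis
    unfolding covered_def set_mset_q[OF k] 1 2 using lin sq by blast
qed

lemma q_nonempty: "q n k \<noteq> {#}"
proof
  assume "q n k = {#}"
  then have "count (q n k) 1 = 0" by simp
  then show False by (auto simp: count_q split: if_splits)
qed

text \<open>The left-hand side of \<open>square_ineqs\<close> is the case \<open>k = 0\<close> of
  \<open>q\<close>, so that all three families have left-hand sides of the form
  \<open>q n k\<close>.\<close>

lemma q_0: "q n 0 = (\<Sum>i\<in>{1..n+1}. {#i, i#})"
  by (simp add: q_def)

text \<open>The summands on the right are the witnesses that \<open>covered\<close> asks for, and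
  the content conditions keep them inside \<open>{1..n+1}\<close>. This serves both for validity in
  the power semiring and for both sides being terms.\<close>

lemma inequalities_covered:
  assumes "e \<in> square_ineqs \<union> linear_ineqs \<union> pair_ineqs"
  shows "\<exists>u v. e = ({u} \<preceq> v) \<and> u \<noteq> {#} \<and> is_term v \<and> covered u v"
proof -
  have count0: "count w i = 0" if "set_mset w \<subseteq> A - {i}" for w and A :: "nat set" and i
    using that by (auto simp: count_eq_zero_iff)
  consider "e \<in> square_ineqs" | "e \<in> linear_ineqs" | "e \<in> pair_ineqs" using assms by blast
  then show ?thesis
  proof cases
    case 1
    then obtain n w where e: "e = ({q n 0} \<preceq> {{#i, i#} + w i | i. i \<in> {1..n+1}})"
      and w: "\<And>i. i \<in> {1..n+1} \<Longrightarrow> set_mset (w i) \<subseteq> {1..n+1} - {i}"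
      unfolding square_ineqs_def q_0 by blast
    let ?V = "{{#i, i#} + w i | i. i \<in> {1..n+1}}"
    have "covered (q n 0) ?V"
    proof (rule covered_q)
      fix i assume i: "i \<in> {0+1..n+1}"
      then have "{#i, i#} + w i \<in> ?V" by auto
      then show "\<exists>w\<in>?V. set_mset w \<subseteq> {1..n+1} \<and> count w i \<ge> 2"
        by (rule bexI[rotated]) (use w[of i] i in auto)
    qed auto
    moreover have "is_term ?V" by (auto simp: is_term_def)
    ultimately show ?thesis using e q_nonempty by blast
  next
    case 2
    then obtain n k w w' where
      e: "e = ({q n k} \<preceq>
       {{#i#} + w i | i. i \<in> {1..k}} \<union>
       {{#i, i#} + w' i | i. i \<in> {1..<k}} \<union>
       {{#i, i#} + w i | i. i \<in> {k+1..n+1}})" (is "_ = (_ \<preceq> ?V)")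
      and k: "1 \<le> k" "k \<le> n + 1"
      and w: "\<And>i. i \<in> {1..n+1} \<Longrightarrow> set_mset (w i) \<subseteq> {1..n+1} - {i}"
      and w': "\<And>i. i \<in> {1..<k} \<Longrightarrow> set_mset (w' i) \<subseteq> {1..n+1} - {i}"
      unfolding linear_ineqs_def by blast
    have "covered (q n k) ?V"
    proof (rule covered_q)
      fix i assume i: "i \<in> {1..k}"
      then have "{#i#} + w i \<in> ?V" by auto
      \<comment> \<open>The exponent of \<open>i\<close> must be exactly one, which rests on
        \<open>w i\<close> not containing \<open>i\<close>.\<close>
      then show "\<exists>w\<in>?V. set_mset w \<subseteq> {1..n+1} \<and> count w i = 1"
        by (rule bexI[rotated]) (use w[of i] count0[OF w[of i]] k i in auto)
    next
      fix i assume i: "i \<in> {k+1..n+1}"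
      then have "{#i, i#} + w i \<in> ?V" by auto
      then show "\<exists>w\<in>?V. set_mset w \<subseteq> {1..n+1} \<and> count w i \<ge> 2"
        by (rule bexI[rotated]) (use w[of i] i in auto)
    next
      fix i j assume ij: "1 \<le> i" "i < j" "j \<le> k"
      \<comment> \<open>Since \<open>i < j \<le> k\<close>, the smaller index lies in
        \<open>{1..<k}\<close> and has a square. Hence every pair is covered although
        \<open>k\<close> itself has none.\<close>
      then have "{#i, i#} + w' i \<in> ?V" by auto
      then show "\<exists>w\<in>?V. set_mset w \<subseteq> {1..n+1} \<and> (count w i \<ge> 2 \<or> count w j \<ge> 2 \<or> (i \<in># w \<and> j \<in># w))"
        by (rule bexI[rotated]) (use w'[of i] k ij in auto)
    qed (rule k)
    moreover have "is_term ?V" using k by (auto simp: is_term_def)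
    ultimately show ?thesis using e q_nonempty by blast
  next
    case 3
    then obtain n k l w w' ww where
      e: "e = ({q n k} \<preceq>
       {{#i#} + w i | i. i \<in> {1..k}} \<union>
       {{#i, i#} + w' i | i. i \<in> {1..l}} \<union>
       {{#i, j#} + ww i j | i j. l + 1 \<le> i \<and> i < j \<and> j \<le> k} \<union>
       {{#i, i#} + w i | i. i \<in> {k+1..n+1}})" (is "_ = (_ \<preceq> ?V)")
      and k: "1 \<le> k" "k \<le> n + 1" "l + 1 < k"
      and w: "\<And>i. i \<in> {1..n+1} \<Longrightarrow> set_mset (w i) \<subseteq> {1..n+1} - {i}"
      and w': "\<And>i. i \<in> {1..l} \<Longrightarrow> set_mset (w' i) \<subseteq> {1..n+1} - {i}"
      and ww: "\<And>i j. \<lbrakk>l + 1 \<le> i; i < j; j \<le> k\<rbrakk> \<Longrightarrow> set_mset (ww i j) \<subseteq> {1..n+1} - {i, j}"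
      unfolding pair_ineqs_def mem_Collect_eq
      by (elim exE conjE) (rule that, assumption, assumption, assumption, assumption, blast, blast, blast)
    have "covered (q n k) ?V"
    proof (rule covered_q)
      fix i assume i: "i \<in> {1..k}"
      then have "{#i#} + w i \<in> ?V" by blast
      then show "\<exists>w\<in>?V. set_mset w \<subseteq> {1..n+1} \<and> count w i = 1"
        by (rule bexI[rotated]) (use w[of i] count0[OF w[of i]] k i in auto)
    next
      fix i assume i: "i \<in> {k+1..n+1}"
      then have "{#i, i#} + w i \<in> ?V" by blast
      then show "\<exists>w\<in>?V. set_mset w \<subseteq> {1..n+1} \<and> count w i \<ge> 2"
        by (rule bexI[rotated]) (use w[of i] i in auto)
    next
      fix i j assume ij: "1 \<le> i" "i < j" "j \<le> k"
      show "\<exists>w\<in>?V. set_mset w \<subseteq> {1..n+1} \<and> (count w i \<ge> 2 \<or> count w j \<ge> 2 \<or> (i \<in># w \<and> j \<in># w))"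
      proof (cases "i \<le> l")
        case True
        then have "{#i, i#} + w' i \<in> ?V" using ij by auto
        then show ?thesis by (rule bexI[rotated]) (use w'[of i] True k ij in auto)
      next
        case False
        then have "l + 1 \<le> i" by simp
        then have "{#i, j#} + ww i j \<in> ?V" using ij by blast
        then show ?thesis by (rule bexI[rotated]) (use ww[OF \<open>l + 1 \<le> i\<close> ij(2,3)] k ij in auto)
      qed
    qed (rule k)
    moreover have "is_term ?V"
    proof -
      have "{{#i, j#} + ww i j | i j. l + 1 \<le> i \<and> i < j \<and> j \<le> k} \<subseteq> (\<lambda>(i, j). {#i, j#} + ww i j) ` ({..k} \<times> {..k})"
        by auto
      then have "finite {{#i, j#} + ww i j | i j. l + 1 \<le> i \<and> i < j \<and> j \<le> k}"
        by (rule finite_subset) simp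
      moreover have "{#1#} + w 1 \<in> ?V" using k(1) by force
      ultimately show ?thesis unfolding is_term_def by auto
    qed
    ultimately show ?thesis using e q_nonempty by blast
  qed
qed

lemma power_semiring_satisfies_cube: "satisfies (power_semiring :: S7 set alg) cube_identity"
proof -
  have "satisfies (power_semiring :: S7 set alg) ({{#0, 0, 0#}} \<preceq> {{#0, 0#}})"
    "satisfies (power_semiring :: S7 set alg) ({{#0, 0#}} \<preceq> {{#0, 0, 0#}})"
    by (rule power_semiring_satisfies; auto simp: covered_def is_term_def)+
  then show ?thesis
    by (simp add: satisfies_def ineq_def cube_identity_def insert_commute)
qed

section \<open>Numbering the variables of a word\<close>

lemma ex_bij_betw_three_blocks:
  assumes "finite A" "finite B" "finite C" "A \<inter> B = {}" "A \<inter> C = {}" "B \<inter> C = {}"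
  shows "\<exists>\<sigma>. bij_betw \<sigma> {1..card A + card B + card C} (A \<union> B \<union> C) \<and> \<sigma> ` {1..card A} \<subseteq> A \<and>
    \<sigma> ` {card A + 1..card A + card B} \<subseteq> B \<and> \<sigma> ` {card A + card B + 1..card A + card B + card C} \<subseteq> C"
proof -
  obtain as bs cs where l: "set as = A" "distinct as" "set bs = B" "distinct bs" "set cs = C" "distinct cs"
    using assms(1-3) finite_distinct_list by metis
  \<comment> \<open>List positions start at 0, the variables at 1.\<close>
  define \<sigma> where "\<sigma> i = (as @ bs @ cs) ! (i - 1)" for i
  have len: "card A = length as" "card B = length bs" "card C = length cs"
    using l distinct_card by metis+
  have "bij_betw ((!) (as @ bs @ cs)) {..<length (as @ bs @ cs)} (A \<union> B \<union> C)"
    using l assms(4-6) by (intro bij_betw_nth) auto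
  moreover have "bij_betw (\<lambda>i. i - 1) {1..length (as @ bs @ cs)} {..<length (as @ bs @ cs)}"
    by (rule bij_betw_byWitness[where f' = Suc]) auto
  ultimately have "bij_betw \<sigma> {1..length (as @ bs @ cs)} (A \<union> B \<union> C)"
    using bij_betw_trans by (force simp: \<sigma>_def[abs_def] comp_def)
  moreover have "\<sigma> i \<in> A" if "i \<in> {1..card A}" for i
    using that len l by (auto simp: \<sigma>_def nth_append)
  moreover have "\<sigma> i \<in> B" if "i \<in> {card A + 1..card A + card B}" for i
    using that len l by (auto simp: \<sigma>_def nth_append)
  moreover have "\<sigma> i \<in> C" if "i \<in> {card A + card B + 1..card A + card B + card C}" for i
    using that len l by (auto simp: \<sigma>_def nth_append)
  ultimately show ?thesis using len by (intro exI[of _ \<sigma>]) (auto simp: add.assoc)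
qed

text \<open>A word is the sum of its letters taken with their multiplicities; the bijection
  reindexes this sum, and the multiplicities one and two are those of \<open>q\<close>.\<close>

lemma image_mset_q:
  assumes k: "k \<le> n + 1" and bij: "bij_betw \<sigma> {1..n+1} (set_mset u)"
    and one: "\<And>i. i \<in> {1..k} \<Longrightarrow> count u (\<sigma> i) = 1" and two: "\<And>i. i \<in> {k+1..n+1} \<Longrightarrow> count u (\<sigma> i) = 2"
  shows "image_mset \<sigma> (q n k) = u"
proof -
  have img: "image_mset \<sigma> (\<Sum>i\<in>I. f i) = (\<Sum>i\<in>I. image_mset \<sigma> (f i))" if "finite I" for I :: "nat set" and f
    using that by (induction I rule: finite_induct) auto
  have "image_mset \<sigma> (q n k) = (\<Sum>i\<in>{1..k}. {#\<sigma> i#}) + (\<Sum>i\<in>{k+1..n+1}. {#\<sigma> i, \<sigma> i#})"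
    by (simp only: q_def image_mset_union img finite_atLeastAtMost image_mset_add_mset image_mset_empty)
  also have "\<dots> = (\<Sum>i\<in>{1..k}. replicate_mset (count u (\<sigma> i)) (\<sigma> i)) +
      (\<Sum>i\<in>{k+1..n+1}. replicate_mset (count u (\<sigma> i)) (\<sigma> i))"
    by (intro arg_cong2[where f = "(+)"] sum.cong refl) (simp_all add: one two numeral_2_eq_2)
  also have "\<dots> = (\<Sum>i\<in>{1..k} \<union> {k+1..n+1}. replicate_mset (count u (\<sigma> i)) (\<sigma> i))"
    by (rule sum.union_disjoint[symmetric]) auto
  also have "{1..k} \<union> {k+1..n+1} = {1..n+1}" using k by auto
  also have "(\<Sum>i\<in>{1..n+1}. replicate_mset (count u (\<sigma> i)) (\<sigma> i)) = (\<Sum>x\<in>set_mset u. replicate_mset (count u x) x)"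
    by (rule sum.reindex_bij_betw[OF bij])
  also have "\<dots> = u"
    by (rule multiset_eqI) (simp add: count_sum not_in_iff[symmetric] sum.delta')
  finally show ?thesis .
qed

section \<open>Deriving covered inequalities from the axioms\<close>

context comm_ai_semiring
begin

lemma wval_cube:
  assumes cube: "satisfies S cube_identity" and \<phi>: "\<phi> \<in> UNIV \<rightarrow> carr S"
  shows "wval S \<phi> (add_mset x (add_mset x (add_mset x w))) = wval S \<phi> (add_mset x (add_mset x w))"
proof -
  have x: "\<phi> x \<in> carr S" using \<phi> by auto
  \<comment> \<open>The constant assignment transfers \<open>cube_identity\<close>, stated for the
    variable \<open>0\<close>, to a variable \<open>x\<close> of any type.\<close>
  then have c: "(\<lambda>_. \<phi> x) \<in> UNIV \<rightarrow> carr S" by auto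
  have "term_val S (\<lambda>_. \<phi> x) (set [{#0, 0, 0#}]) = term_val S (\<lambda>_. \<phi> x) (set [{#0, 0#}])"
    using cube c unfolding satisfies_def cube_identity_def fst_conv snd_conv list.set by blast
  then have "wval S (\<lambda>_. \<phi> x) {#0, 0, 0::nat#} = wval S (\<lambda>_. \<phi> x) {#0, 0::nat#}"
    using c by (subst (asm) (1 2) term_val_eq_tval) (auto simp: is_term_def tval_def)
  then have "\<phi> x \<otimes> (\<phi> x \<otimes> \<phi> x) = \<phi> x \<otimes> \<phi> x"
    using wval_mset[OF c, of "[0, 0, 0::nat]"] wval_mset[OF c, of "[0, 0::nat]"] by simp
  then have *: "wval S \<phi> {#x, x, x#} = wval S \<phi> {#x, x#}"
    using wval_mset[OF \<phi>, of "[x, x, x]"] wval_mset[OF \<phi>, of "[x, x]"] by simp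
  show ?thesis
  proof (cases "w = {#}")
    case False
    then show ?thesis using * wval_plus[OF \<phi>, of "{#x, x, x#}" w] wval_plus[OF \<phi>, of "{#x, x#}" w] by simp
  qed (use * in simp)
qed

text \<open>Surplus copies of \<open>x\<close> are removed by \<open>cube_identity\<close> until
  exactly two are left. The cofactor then avoids \<open>x\<close>, as the axioms demand of the words
  multiplied with a square.\<close>

lemma wval_split_square:
  assumes cube: "satisfies S cube_identity" and \<phi>: "\<phi> \<in> UNIV \<rightarrow> carr S"
  shows "count w x \<ge> 2 \<Longrightarrow> \<exists>v. x \<notin># v \<and> set_mset v \<subseteq> set_mset w \<and> wval S \<phi> w = wval S \<phi> ({#x, x#} + v)"
proof (induction "size w" arbitrary: w rule: less_induct)
  case less
  then have "{#x, x#} \<subseteq># w" by (auto simp: subseteq_mset_def)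
  then obtain v where v: "w = {#x, x#} + v" by (metis subset_mset.le_iff_add)
  show ?case
  proof (cases "x \<in># v")
    case True
    then obtain v' where v': "v = add_mset x v'" by (metis insert_DiffM)
    have "\<exists>r. x \<notin># r \<and> set_mset r \<subseteq> set_mset v \<and> wval S \<phi> (add_mset x v) = wval S \<phi> ({#x, x#} + r)"
      using less.hyps[of "add_mset x v"] v v' by auto
    then show ?thesis using wval_cube[OF cube \<phi>, of x v'] v v' by auto
  qed (use v in auto)
qed

lemma wval_truncate:
  assumes cube: "satisfies S cube_identity" and \<phi>: "\<phi> \<in> UNIV \<rightarrow> carr S"
  shows "\<exists>v. (\<forall>x. count v x = min 2 (count u x)) \<and> wval S \<phi> v = wval S \<phi> u"
proof (induction "size u" arbitrary: u rule: less_induct)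
  case less
  show ?case
  proof (cases "\<forall>x. count u x \<le> 2")
    case True
    then show ?thesis by (intro exI[of _ u]) auto
  next
    case False
    then obtain x where "count u x > 2" by (auto simp: not_le)
    then have "{#x, x, x#} \<subseteq># u" by (auto simp: subseteq_mset_def)
    then obtain v where v: "u = {#x, x, x#} + v" by (metis subset_mset.le_iff_add)
    obtain r where r: "\<forall>y. count r y = min 2 (count ({#x, x#} + v) y)" "wval S \<phi> r = wval S \<phi> ({#x, x#} + v)"
      using less.hyps[of "{#x, x#} + v"] v by auto
    have "min 2 (count ({#x, x#} + v) y) = min 2 (count u y)" for y using v by auto
    then show ?thesis using r wval_cube[OF cube \<phi>, of x v] v by (intro exI[of _ r]) auto
  qed
qed

text \<open>\<open>covered\<close> distinguishes only the exponents 0, 1 and at least 2, and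
  truncation at 2 preserves these three classes.\<close>

lemma covered_truncate:
  assumes "covered u V" "\<forall>x. count v x = min 2 (count u x)"
  shows "covered v V"
proof -
  have "count v x = 1 \<longleftrightarrow> count u x = 1" "2 \<le> count v x \<longleftrightarrow> 2 \<le> count u x" for x
    using assms(2) by (auto simp: min_def)
  moreover have "x \<in># v \<longleftrightarrow> x \<in># u" for x
    using assms(2) unfolding count_greater_zero_iff[symmetric] by simp
  ultimately show ?thesis using assms(1) unfolding covered_def subset_iff by simp
qed

text \<open>If \<open>u\<close> has at least two variables, a single axiom suffices: a renaming
  turns \<open>u\<close> into some \<open>q n k\<close>, and the cofactors are what remains of the
  covering words. As \<open>z\<close> bounds all words of \<open>V\<close>, every summand on the
  right of that axiom is below \<open>z\<close>, hence so is \<open>u\<close>.\<close>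

lemma covered_imp_below_truncated:
  fixes \<phi> :: "'x \<Rightarrow> 'a"
  assumes ax: "\<forall>e \<in> {cube_identity} \<union> square_ineqs \<union> linear_ineqs \<union> pair_ineqs. satisfies S e"
    and \<phi>: "\<phi> \<in> UNIV \<rightarrow> carr S" and z: "z \<in> carr S"
    and V: "\<And>w. w \<in> V \<Longrightarrow> below S (wval S \<phi> w) z"
    and cov: "covered u V" and two: "\<And>x. count u x \<le> 2" and "u \<noteq> {#}"
  shows "below S (wval S \<phi> u) z"
proof -
  have cube: "satisfies S cube_identity" using ax by blast
  \<comment> \<open>The split decides the axiom. A variable of \<open>L\<^sub>1\<close> can feed a
    summand with cofactor \<open>w'\<close>, whereas two variables of \<open>L\<^sub>2\<close> have
    to occur together in a word.\<close>
  define L\<^sub>1 where "L\<^sub>1 = {x \<in> set_mset u. count u x = 1 \<and> (\<exists>w\<in>V. set_mset w \<subseteq> set_mset u \<and> count w x \<ge> 2)}"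
  define L\<^sub>2 where "L\<^sub>2 = {x \<in> set_mset u. count u x = 1} - L\<^sub>1"
  define Q where "Q = {x \<in> set_mset u. count u x = 2}"
  have split_u: "L\<^sub>1 \<union> L\<^sub>2 \<union> Q = set_mset u"
  proof -
    have "count u x = 1 \<or> count u x = 2" if "x \<in># u" for x
      using two[of x] that[folded count_greater_zero_iff] by linarith
    then show ?thesis by (auto simp: L\<^sub>1_def L\<^sub>2_def Q_def)
  qed
  have fin: "finite L\<^sub>1" "finite L\<^sub>2" "finite Q" by (auto simp: L\<^sub>1_def L\<^sub>2_def Q_def)
  have dis: "L\<^sub>1 \<inter> L\<^sub>2 = {}" "L\<^sub>1 \<inter> Q = {}" "L\<^sub>2 \<inter> Q = {}" by (auto simp: L\<^sub>1_def L\<^sub>2_def Q_def)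

  have square: "\<exists>r. set_mset r \<subseteq> set_mset u - {x} \<and> below S (wval S \<phi> ({#x, x#} + r)) z"
    if w: "w \<in> V" "set_mset w \<subseteq> set_mset u" "count w x \<ge> 2" for w x
  proof -
    obtain r where "x \<notin># r" "set_mset r \<subseteq> set_mset w" "wval S \<phi> w = wval S \<phi> ({#x, x#} + r)"
      using wval_split_square[OF cube \<phi> w(3)] by blast
    then show ?thesis using V[OF w(1)] w(2) by (intro exI[of _ r]) auto
  qed
  \<comment> \<open>One family \<open>R\<close> serves linear and nonlinear variables alike,
    matching the single family \<open>w\<close> of the axioms.\<close>
  have "\<exists>r. set_mset r \<subseteq> set_mset u - {x} \<and>
      below S (wval S \<phi> ((if x \<in> Q then {#x, x#} else {#x#}) + r)) z" if "x \<in># u" for x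
  proof (cases "x \<in> Q")
    case True
    then have "count u x \<ge> 2" by (simp add: Q_def)
    then obtain w where "w \<in> V" "set_mset w \<subseteq> set_mset u" "count w x \<ge> 2"
      using covered_square[OF cov] by blast
    then show ?thesis using square True by simp
  next
    case False
    then have "count u x = 1" using that split_u by (auto simp: L\<^sub>1_def L\<^sub>2_def)
    then obtain w where w: "w \<in> V" "set_mset w \<subseteq> set_mset u" "count w x = 1"
      using covered_linear[OF cov] by blast
    then have "x \<in># w" by (simp flip: count_greater_zero_iff)
    then obtain r where r: "w = add_mset x r" by (metis insert_DiffM)
    then have "x \<notin># r" using w(3) by (simp add: not_in_iff)
    then show ?thesis using r V[OF w(1)] w(2) False by (intro exI[of _ r]) auto
  qed
  then obtain R where R: "\<And>x. x \<in># u \<Longrightarrow> set_mset (R x) \<subseteq> set_mset u - {x}"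
      "\<And>x. x \<in># u \<Longrightarrow> below S (wval S \<phi> ((if x \<in> Q then {#x, x#} else {#x#}) + R x)) z"
    by metis
  have "\<exists>r. set_mset r \<subseteq> set_mset u - {x} \<and> below S (wval S \<phi> ({#x, x#} + r)) z" if "x \<in> L\<^sub>1" for x
    using that square unfolding L\<^sub>1_def by blast
  then obtain R' where R': "\<And>x. x \<in> L\<^sub>1 \<Longrightarrow> set_mset (R' x) \<subseteq> set_mset u - {x}"
      "\<And>x. x \<in> L\<^sub>1 \<Longrightarrow> below S (wval S \<phi> ({#x, x#} + R' x)) z"
    by metis
  have "\<exists>r. set_mset r \<subseteq> set_mset u - {x, y} \<and> below S (wval S \<phi> ({#x, y#} + r)) z"
    if xy: "x \<in> L\<^sub>2" "y \<in> L\<^sub>2" "x \<noteq> y" for x y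
  proof -
    have "count u x = 1" "count u y = 1" using xy by (auto simp: L\<^sub>2_def)
    then obtain w where w: "w \<in> V" "set_mset w \<subseteq> set_mset u"
        "count w x \<ge> 2 \<or> count w y \<ge> 2 \<or> (x \<in># w \<and> y \<in># w)"
      using covered_pair[OF cov _ _ xy(3)] by blast
    \<comment> \<open>By the choice of \<open>L\<^sub>2\<close> no admissible word contains a square
      of \<open>x\<close> or \<open>y\<close>, so the pair clause yields a word with both, each
      occurring exactly once.\<close>
    then have lt: "count w x < 2" "count w y < 2"
      using xy unfolding L\<^sub>2_def L\<^sub>1_def by (auto simp: not_le[symmetric])
    then have mem: "x \<in># w" "y \<in># w" using w by auto
    then have "{#x, y#} \<subseteq># w" using xy(3) by (auto simp: subseteq_mset_def Suc_le_eq)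
    then obtain r where r: "w = {#x, y#} + r" by (metis subset_mset.le_iff_add)
    then have "x \<notin># r" "y \<notin># r" using lt xy(3) by (auto simp: not_in_iff)
    then show ?thesis using r V[OF w(1)] w(2) by (intro exI[of _ r]) auto
  qed
  then obtain RR where RR: "\<And>x y. \<lbrakk>x \<in> L\<^sub>2; y \<in> L\<^sub>2; x \<noteq> y\<rbrakk> \<Longrightarrow> set_mset (RR x y) \<subseteq> set_mset u - {x, y}"
      "\<And>x y. \<lbrakk>x \<in> L\<^sub>2; y \<in> L\<^sub>2; x \<noteq> y\<rbrakk> \<Longrightarrow> below S (wval S \<phi> ({#x, y#} + RR x y)) z"
    by metis

  define N where "N = card L\<^sub>1 + card L\<^sub>2 + card Q"
  define k where "k = card L\<^sub>1 + card L\<^sub>2"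
  define l where "l = card L\<^sub>1"
  obtain \<sigma> where bij: "bij_betw \<sigma> {1..N} (set_mset u)"
    and \<sigma>1: "\<And>i. i \<in> {1..l} \<Longrightarrow> \<sigma> i \<in> L\<^sub>1" and \<sigma>2: "\<And>i. i \<in> {l + 1..k} \<Longrightarrow> \<sigma> i \<in> L\<^sub>2"
    and \<sigma>3: "\<And>i. i \<in> {k + 1..N} \<Longrightarrow> \<sigma> i \<in> Q"
    using ex_bij_betw_three_blocks[OF fin dis] unfolding split_u N_def k_def l_def image_subset_iff by blast
  have "N = card (set_mset u)" using bij bij_betw_same_card by fastforce
  then have "N \<noteq> 0" using \<open>u \<noteq> {#}\<close> by simp
  then obtain n where n: "N = n + 1" by (metis Suc_eq_plus1 not0_implies_Suc)
  have lk: "l \<le> k" "k \<le> n + 1" using n by (auto simp: l_def k_def N_def)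
  \<comment> \<open>The inverse of \<open>\<sigma>\<close> carries the cofactors, which are words
    over the content of \<open>u\<close>, to the variables \<open>1, ..., n + 1\<close> of the
    axioms; these are then evaluated under \<open>\<phi> \<circ> \<sigma>\<close>.\<close>
  define \<tau> where "\<tau> = the_inv_into {1..n+1} \<sigma>"
  have \<sigma>\<tau>: "\<sigma> (\<tau> x) = x" "\<tau> x \<in> {1..n+1}" if "x \<in># u" for x
    using bij that n unfolding \<tau>_def bij_betw_def
    by (auto intro: f_the_inv_into_f the_inv_into_into simp del: atLeastAtMost_iff)
  have \<tau>\<sigma>: "\<tau> (\<sigma> i) = i" if "i \<in> {1..n+1}" for i
    using bij that n unfolding \<tau>_def bij_betw_def by (auto intro: the_inv_into_f_f)
  have \<sigma>u: "\<sigma> i \<in># u" if "i \<in> {1..n+1}" for i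
    using bij that n by (auto simp: bij_betw_def)
  have \<phi>\<sigma>: "\<phi> \<circ> \<sigma> \<in> UNIV \<rightarrow> carr S" using \<phi> by auto
  have pull: "image_mset \<sigma> (image_mset \<tau> w) = w" if "set_mset w \<subseteq> set_mset u" for w
  proof -
    have "image_mset \<sigma> (image_mset \<tau> w) = image_mset id w"
      unfolding multiset.map_comp by (rule image_mset_cong) (use that \<sigma>\<tau> in auto)
    then show ?thesis by simp
  qed
  have val: "wval S (\<phi> \<circ> \<sigma>) (m + image_mset \<tau> r) = wval S \<phi> (image_mset \<sigma> m + r)" if "set_mset r \<subseteq> set_mset u" for m r
    unfolding wval_image_mset[OF \<phi>, symmetric] using pull[OF that] by simp
  have sub: "set_mset (image_mset \<tau> r) \<subseteq> {1..n+1} - I"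
    if "set_mset r \<subseteq> set_mset u - \<sigma> ` I" for r I
  proof
    fix i assume "i \<in># image_mset \<tau> r"
    then obtain x where x: "x \<in># r" "i = \<tau> x" by auto
    then have "x \<in># u" "x \<notin> \<sigma> ` I" using that by auto
    then show "i \<in> {1..n+1} - I" using \<sigma>\<tau>[of x] x(2) by (metis DiffI imageI)
  qed

  define w where "w i = image_mset \<tau> (R (\<sigma> i))" for i
  define w' where "w' i = image_mset \<tau> (R' (\<sigma> i))" for i
  define ww where "ww i j = image_mset \<tau> (RR (\<sigma> i) (\<sigma> j))" for i j
  have w: "set_mset (w i) \<subseteq> {1..n+1} - {i}" if "i \<in> {1..n+1}" for i
    unfolding w_def using R(1)[OF \<sigma>u[OF that]] by (intro sub) simp
  have w': "set_mset (w' i) \<subseteq> {1..n+1} - {i}" if "i \<in> {1..l}" for i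
    unfolding w'_def using R'(1)[OF \<sigma>1[OF that]] by (intro sub) simp
  have neq: "\<sigma> i \<noteq> \<sigma> j" if "i \<in> {l + 1..k}" "j \<in> {l + 1..k}" "i < j" for i j
    using \<tau>\<sigma>[of i] \<tau>\<sigma>[of j] that lk by auto
  have ww: "set_mset (ww i j) \<subseteq> {1..n+1} - {i, j}" if "i \<in> {l + 1..k}" "j \<in> {l + 1..k}" "i < j" for i j
    unfolding ww_def using RR(1)[OF \<sigma>2[OF that(1)] \<sigma>2[OF that(2)] neq[OF that]] by (intro sub) simp
  have w_lin: "below S (wval S (\<phi> \<circ> \<sigma>) ({#i#} + w i)) z" if "i \<in> {1..k}" for i
  proof -
    have "\<sigma> i \<notin> Q" using \<sigma>1[of i] \<sigma>2[of i] that dis by (cases "i \<le> l") auto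
    moreover have "\<sigma> i \<in># u" using that lk by (intro \<sigma>u) auto
    ultimately show ?thesis using R[of "\<sigma> i"] unfolding w_def by (subst val) auto
  qed
  have w_sq: "below S (wval S (\<phi> \<circ> \<sigma>) ({#i, i#} + w i)) z" if "i \<in> {k + 1..n + 1}" for i
  proof -
    have "\<sigma> i \<in> Q" using \<sigma>3[of i] that n by auto
    moreover have "\<sigma> i \<in># u" using that by (intro \<sigma>u) auto
    ultimately show ?thesis using R[of "\<sigma> i"] unfolding w_def by (subst val) auto
  qed
  have w'_sq: "below S (wval S (\<phi> \<circ> \<sigma>) ({#i, i#} + w' i)) z" if "i \<in> {1..l}" for i
    using R'[OF \<sigma>1[OF that]] unfolding w'_def by (subst val) auto
  have ww_pair: "below S (wval S (\<phi> \<circ> \<sigma>) ({#i, j#} + ww i j)) z"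
    if "i \<in> {l + 1..k}" "j \<in> {l + 1..k}" "i < j" for i j
    using RR[OF \<sigma>2[OF that(1)] \<sigma>2[OF that(2)] neq[OF that]] unfolding ww_def by (subst val) auto

  have uq: "u = image_mset \<sigma> (q n k)"
  proof (rule image_mset_q[symmetric])
    show "count u (\<sigma> i) = 1" if "i \<in> {1..k}" for i
      using \<sigma>1[of i] \<sigma>2[of i] that by (cases "i \<le> l") (auto simp: L\<^sub>1_def L\<^sub>2_def)
    show "count u (\<sigma> i) = 2" if "i \<in> {k + 1..n + 1}" for i
      using \<sigma>3[of i] that n by (auto simp: Q_def)
  qed (use lk bij n in auto)
  \<comment> \<open>It remains to name, in each case, a right-hand side \<open>T\<close> that fits
    \<open>q n k\<close> and has all its words below \<open>z\<close>.\<close>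
  have by_ineq: "below S (wval S \<phi> u) z"
    if e: "({q n k} \<preceq> T) \<in> square_ineqs \<union> linear_ineqs \<union> pair_ineqs"
      and T: "\<And>t. t \<in> T \<Longrightarrow> below S (wval S (\<phi> \<circ> \<sigma>) t) z" for T
  proof -
    have "is_term T" using inequalities_covered[OF e] by (auto simp: ineq_def)
    moreover have "satisfies S ({q n k} \<preceq> T)" using ax e by blast
    ultimately have "below S (wval S (\<phi> \<circ> \<sigma>) (q n k)) z"
      using satisfies_ineq_iff[OF q_nonempty] \<phi>\<sigma> z T by blast
    then show ?thesis unfolding uq wval_image_mset[OF \<phi>] .
  qed

  show ?thesis
  proof (cases "n \<ge> 1")
    case False
    \<comment> \<open>The axioms start at \<open>n = 1\<close>. With a single variable the content
      condition forces the cofactor to be empty, so the summand below \<open>z\<close> is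
      \<open>q n k\<close> itself.\<close>
    then have n0: "n = 0" by simp
    have r0: "w 1 = {#}" using w[of 1] n0 by auto
    have "below S (wval S (\<phi> \<circ> \<sigma>) (q n k)) z"
    proof (cases "k = 0")
      case True
      then have "q n k = {#1, 1#} + w 1" using n0 r0 by (simp add: q_def)
      then show ?thesis using w_sq[of 1] True n0 by simp
    next
      case False
      then have "k = 1" using lk n0 by simp
      then have "q n k = {#1#} + w 1" using n0 r0 by (simp add: q_def)
      then show ?thesis using w_lin[of 1] \<open>k = 1\<close> by simp
    qed
    then show ?thesis unfolding uq wval_image_mset[OF \<phi>] .
  next
    case n1: True
    \<comment> \<open>If at most one linear variable lacks a square, then \<open>{1..<k}\<close>
      lies in \<open>{1..l}\<close> and \<open>linear_ineqs\<close> applies; otherwise there are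
      pairs left to cover, and \<open>l + 1 < k\<close> is the range of
      \<open>pair_ineqs\<close>.\<close>
    consider "k = 0" | "k \<ge> 1" "k \<le> l + 1" | "l + 1 < k" by linarith
    then show ?thesis
    proof cases
      case 1
      show ?thesis
      proof (rule by_ineq)
        show "({q n k} \<preceq> {{#i, i#} + w i | i. i \<in> {1..n+1}}) \<in> square_ineqs \<union> linear_ineqs \<union> pair_ineqs"
          unfolding 1 q_0 square_ineqs_def using n1 w by blast
        show "below S (wval S (\<phi> \<circ> \<sigma>) t) z" if "t \<in> {{#i, i#} + w i | i. i \<in> {1..n+1}}" for t
          using that w_sq 1 by auto
      qed
    next
      case 2
      let ?T = "{{#i#} + w i | i. i \<in> {1..k}} \<union> {{#i, i#} + w' i | i. i \<in> {1..<k}} \<union>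
        {{#i, i#} + w i | i. i \<in> {k+1..n+1}}"
      have w'2: "\<forall>i\<in>{1..<k}. set_mset (w' i) \<subseteq> {1..n+1} - {i}"
      proof
        fix i assume "i \<in> {1..<k}"
        then show "set_mset (w' i) \<subseteq> {1..n+1} - {i}" using 2 by (intro w') auto
      qed
      show ?thesis
      proof (rule by_ineq)
        have "({q n k} \<preceq> ?T) \<in> linear_ineqs"
          unfolding linear_ineqs_def mem_Collect_eq
          by (intro exI conjI; (rule refl n1 w'2 lk(2) 2(1))?) (use w in blast)
        then show "({q n k} \<preceq> ?T) \<in> square_ineqs \<union> linear_ineqs \<union> pair_ineqs" by blast
        show "below S (wval S (\<phi> \<circ> \<sigma>) t) z" if "t \<in> ?T" for t
        proof -
          have "i \<in> {1..l}" if "i \<in> {1..<k}" for i using that 2 by auto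
          then show ?thesis using \<open>t \<in> ?T\<close> w_lin w_sq w'_sq by blast
        qed
      qed
    next
      case 3
      let ?T = "{{#i#} + w i | i. i \<in> {1..k}} \<union> {{#i, i#} + w' i | i. i \<in> {1..l}} \<union>
        {{#i, j#} + ww i j | i j. l + 1 \<le> i \<and> i < j \<and> j \<le> k} \<union>
        {{#i, i#} + w i | i. i \<in> {k+1..n+1}}"
      have range: "i \<in> {l + 1..k}" "j \<in> {l + 1..k}" if "l + 1 \<le> i" "i < j" "j \<le> k" for i j
        using that by auto
      have ww3: "\<forall>i j. l + 1 \<le> i \<and> i < j \<and> j \<le> k \<longrightarrow> set_mset (ww i j) \<subseteq> {1..n+1} - {i, j}"
        using ww range by blast
      have k1: "1 \<le> k" using 3 by simp
      show ?thesis
      proof (rule by_ineq)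
        have "({q n k} \<preceq> ?T) \<in> pair_ineqs"
          unfolding pair_ineqs_def mem_Collect_eq
          by (intro exI conjI; (rule refl n1 ww3 lk(2) k1 3)?) (use w w' in blast)+
        then show "({q n k} \<preceq> ?T) \<in> square_ineqs \<union> linear_ineqs \<union> pair_ineqs" by blast
        show "below S (wval S (\<phi> \<circ> \<sigma>) t) z" if "t \<in> ?T" for t
        proof -
          consider i where "t = {#i#} + w i" "i \<in> {1..k}" | i where "t = {#i, i#} + w' i" "i \<in> {1..l}"
            | i j where "t = {#i, j#} + ww i j" "l + 1 \<le> i" "i < j" "j \<le> k"
            | i where "t = {#i, i#} + w i" "i \<in> {k+1..n+1}"
            using \<open>t \<in> ?T\<close> by blast
          then show ?thesis using w_lin w_sq w'_sq ww_pair range by cases auto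
        qed
      qed
    qed
  qed
qed

text \<open>Truncating the exponents at two changes neither the value of \<open>u\<close> nor its
  being covered, and leads to \<open>covered_imp_below_truncated\<close>.\<close>

lemma covered_imp_below:
  assumes ax: "\<forall>e \<in> {cube_identity} \<union> square_ineqs \<union> linear_ineqs \<union> pair_ineqs. satisfies S e"
    and \<phi>: "\<phi> \<in> UNIV \<rightarrow> carr S" and z: "z \<in> carr S"
    and V: "\<And>w. w \<in> V \<Longrightarrow> below S (wval S \<phi> w) z"
    and cov: "covered u V" and "u \<noteq> {#}"
  shows "below S (wval S \<phi> u) z"
proof -
  obtain v where v: "\<forall>x. count v x = min 2 (count u x)" "wval S \<phi> v = wval S \<phi> u"
    using wval_truncate[OF _ \<phi>] ax by blast
  obtain x where "x \<in># u" using \<open>u \<noteq> {#}\<close> by auto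
  then have "x \<in># v" using v(1) by (simp flip: count_greater_zero_iff)
  then have "v \<noteq> {#}" by auto
  moreover have "count v x \<le> 2" for x using v(1) by simp
  ultimately show ?thesis
    using covered_imp_below_truncated[OF ax \<phi> z V covered_truncate[OF cov v(1)]] v(2) by simp
qed

end

section \<open>Varieties\<close>

text \<open>Both evaluations fold along the same enumerations, since these are chosen from the word
  or term alone, and a homomorphism passes through each fold.\<close>

lemma term_val_hom:
  assumes closed: "\<And>x y. \<lbrakk>x \<in> carr A; y \<in> carr A\<rbrakk> \<Longrightarrow> add A x y \<in> carr A \<and> mul A x y \<in> carr A"
    and hom: "\<And>x y. \<lbrakk>x \<in> carr A; y \<in> carr A\<rbrakk> \<Longrightarrow>
      h (add A x y) = add B (h x) (h y) \<and> h (mul A x y) = mul B (h x) (h y)"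
    and \<psi>: "\<psi> \<in> UNIV \<rightarrow> carr A" and t: "is_term t"
  shows "term_val A \<psi> t \<in> carr A" "term_val B (h \<circ> \<psi>) t = h (term_val A \<psi> t)"
proof -
  have word: "word_val A \<psi> w \<in> carr A \<and> word_val B (h \<circ> \<psi>) w = h (word_val A \<psi> w)" if "w \<noteq> {#}" for w
  proof -
    define xs where "xs = (SOME xs. mset xs = w)"
    have "mset xs = w" unfolding xs_def by (rule someI_ex[OF ex_mset])
    then have "map \<psi> xs \<noteq> []" "set (map \<psi> xs) \<subseteq> carr A" using that \<psi> by auto
    then have "fold1 (mul A) (map \<psi> xs) \<in> carr A"
      "fold1 (mul B) (map h (map \<psi> xs)) = h (fold1 (mul A) (map \<psi> xs))"
      using fold1_closed[of "carr A" "mul A"] fold1_hom[of "carr A" "mul A" h "mul B"] closed hom by blast+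
    then show ?thesis by (simp add: word_val_def xs_def)
  qed
  define ws where "ws = (SOME ws. set ws = t)"
  have "\<exists>ws. set ws = t" using t finite_list by (auto simp: is_term_def)
  then have ws: "set ws = t" unfolding ws_def by (rule someI_ex)
  have W: "word_val A \<psi> w \<in> carr A \<and> word_val B (h \<circ> \<psi>) w = h (word_val A \<psi> w)" if "w \<in> set ws" for w
    using word[of w] that t ws by (metis is_term_def)
  then have ne: "map (word_val A \<psi>) ws \<noteq> []" "set (map (word_val A \<psi>) ws) \<subseteq> carr A"
    using t ws by (auto simp: is_term_def)
  have "map (word_val B (h \<circ> \<psi>)) ws = map h (map (word_val A \<psi>) ws)"
    using W by simp
  moreover have "fold1 (add A) (map (word_val A \<psi>) ws) \<in> carr A"
      "fold1 (add B) (map h (map (word_val A \<psi>) ws)) = h (fold1 (add A) (map (word_val A \<psi>) ws))"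
    using fold1_closed[of "carr A" "add A"] fold1_hom[of "carr A" "add A" h "add B"] closed hom ne by blast+
  ultimately show "term_val A \<psi> t \<in> carr A" "term_val B (h \<circ> \<psi>) t = h (term_val A \<psi> t)"
    unfolding term_val_def ws_def[symmetric] by metis+
qed

section \<open>Subalgebras of direct powers and their homomorphic images\<close>

context
  fixes A :: "'a alg" and B :: "'b alg" and I :: "'i set" and U h D
  assumes sub: "subuniverse U (direct_power I A)"
    and hom: "hom_onto h (direct_power I A\<lparr>carr := U\<rparr>) B"
  defines "D \<equiv> direct_power I A\<lparr>carr := U\<rparr>"
begin

lemma subpower_closed:
  "\<lbrakk>f \<in> U; g \<in> U\<rbrakk> \<Longrightarrow> add D f g \<in> U \<and> mul D f g \<in> U"
  using sub by (simp add: subuniverse_def D_def)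

lemma subpower_apply:
  assumes "i \<in> I"
  shows "add D f g i = add A (f i) (g i)" "mul D f g i = mul A (f i) (g i)"
  using assms by (simp_all add: direct_power_def D_def)

lemma subpower_mem: "f \<in> U \<Longrightarrow> f \<in> I \<rightarrow>\<^sub>E carr A"
  using sub by (auto simp: subuniverse_def direct_power_def)

lemma subpower_eqI:
  assumes "f \<in> U" "g \<in> U" "\<And>i. i \<in> I \<Longrightarrow> f i = g i"
  shows "f = g"
  using assms PiE_ext[OF subpower_mem subpower_mem] by blast

lemma image_hom:
  "\<lbrakk>f \<in> U; g \<in> U\<rbrakk> \<Longrightarrow> h (add D f g) = add B (h f) (h g) \<and> h (mul D f g) = mul B (h f) (h g)"
  using hom by (simp add: hom_onto_def D_def)

lemma image_onto: "carr B = h ` U"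
  using hom by (simp add: hom_onto_def)

lemma subpower_comm_ai_semiring:
  assumes "comm_ai_semiring A"
  shows "comm_ai_semiring D"
proof -
  interpret comm_ai_semiring A by fact
  have [simp]: "carr D = U" by (simp add: D_def)
  have val: "f i \<in> carr A" if "f \<in> U" "i \<in> I" for f i using subpower_mem that by auto
  show ?thesis
  proof
    show "carr D \<noteq> {}" using sub by (simp add: subuniverse_def)
  qed (auto simp: subpower_closed intro!: subpower_eqI,
      auto simp: subpower_apply val add_assoc add_idem mul_assoc distrib_left distrib_right
        intro: add_comm mul_comm)
qed

lemma image_comm_ai_semiring:
  assumes "comm_ai_semiring A"
  shows "comm_ai_semiring B"
proof -
  interpret D: comm_ai_semiring D by (rule subpower_comm_ai_semiring[OF assms])
  have [simp]: "carr D = U" by (simp add: D_def)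
  show ?thesis
  proof
    show "carr B \<noteq> {}" using sub by (simp add: image_onto subuniverse_def)
  qed (auto simp: image_onto subpower_closed simp flip: image_hom,
      (simp_all add: D.add_assoc D.add_idem D.mul_assoc D.distrib_left D.distrib_right D.add_comm D.mul_comm)?)
qed

text \<open>An assignment into \<open>B\<close> lifts along the surjection \<open>h\<close> to one
  into \<open>U\<close>. There the identity is checked coordinate by coordinate, each projection
  being a homomorphism to \<open>A\<close>, and \<open>h\<close> carries it back to
  \<open>B\<close>.\<close>

lemma image_satisfies:
  assumes A: "satisfies A e" and e: "is_term (fst e)" "is_term (snd e)"
  shows "satisfies B e"
  unfolding satisfies_def
proof
  fix \<phi> :: "nat \<Rightarrow> 'b" assume "\<phi> \<in> UNIV \<rightarrow> carr B"
  then have "\<forall>n. \<exists>f. f \<in> U \<and> h f = \<phi> n" unfolding image_onto by (metis UNIV_I funcset_mem imageE)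
  then obtain \<psi> where \<psi>: "\<And>n. \<psi> n \<in> U" "\<And>n. h (\<psi> n) = \<phi> n" by metis
  then have \<phi>: "\<phi> = h \<circ> \<psi>" by auto
  have carr: "carr D = U" by (simp add: D_def)
  have \<psi>U: "\<psi> \<in> UNIV \<rightarrow> carr D" using \<psi> by (simp add: carr)
  have closed: "add D f g \<in> carr D \<and> mul D f g \<in> carr D" if "f \<in> carr D" "g \<in> carr D" for f g
    using that subpower_closed by (simp add: carr)
  have "term_val D \<psi> (fst e) = term_val D \<psi> (snd e)"
  proof (rule subpower_eqI)
    show "term_val D \<psi> (fst e) \<in> U" "term_val D \<psi> (snd e) \<in> U"
      using term_val_hom(1)[OF closed _ \<psi>U, where h = h and B = B] image_hom e by (simp_all add: carr)
    fix i assume i: "i \<in> I"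
    have "term_val A ((\<lambda>f. f i) \<circ> \<psi>) t = term_val D \<psi> t i" if "is_term t" for t
      using closed subpower_apply[OF i] \<psi>U that by (intro term_val_hom(2)) auto
    moreover have "(\<lambda>f. f i) \<circ> \<psi> \<in> UNIV \<rightarrow> carr A" using subpower_mem \<psi>(1) i by fastforce
    ultimately show "term_val D \<psi> (fst e) i = term_val D \<psi> (snd e) i"
      using A e by (metis satisfies_def)
  qed
  moreover have "term_val B \<phi> t = h (term_val D \<psi> t)" if "is_term t" for t
    unfolding \<phi> using closed image_hom \<psi>U that by (intro term_val_hom(2)) (auto simp: carr)
  ultimately show "term_val B \<phi> (fst e) = term_val B \<phi> (snd e)" using e by simp
qed

end

section \<open>Soundness of the axioms, and models as quotients of free algebras\<close>

lemma identities_are_terms: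
  assumes "e \<in> {cube_identity} \<union> square_ineqs \<union> linear_ineqs \<union> pair_ineqs"
  shows "is_term (fst e)" "is_term (snd e)"
proof -
  have "is_term (fst e) \<and> is_term (snd e)"
  proof (cases "e = cube_identity")
    case True
    then show ?thesis by (simp add: cube_identity_def is_term_def)
  next
    case False
    then obtain u v where "e = ({u} \<preceq> v)" "u \<noteq> {#}" "is_term v"
      using inequalities_covered[of e] assms by blast
    then show ?thesis by (auto simp: ineq_def is_term_def)
  qed
  then show "is_term (fst e)" "is_term (snd e)" by auto
qed

lemma power_semiring_satisfies_identities:
  assumes "e \<in> {cube_identity} \<union> square_ineqs \<union> linear_ineqs \<union> pair_ineqs"
  shows "satisfies (power_semiring :: S7 set alg) e"
proof (cases "e = cube_identity")
  case False
  then show ?thesis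
    using inequalities_covered[of e] assms power_semiring_satisfies by blast
qed (simp add: power_semiring_satisfies_cube)

text \<open>The terms in the variables \<open>'b\<close> form a free algebra of the variety, represented in the
  direct power indexed by all assignments \<open>'b \<Rightarrow> S7 set\<close>. Since assignments must land
  in \<open>carr B\<close>, the elements outside the carrier are evaluated at some fixed element of it.\<close>

lemma model_in_variety:
  fixes B :: "'b alg"
  assumes "comm_ai_semiring B"
    and ax: "\<forall>e \<in> {cube_identity} \<union> square_ineqs \<union> linear_ineqs \<union> pair_ineqs. satisfies B e"
  shows "B \<in> variety_generated (power_semiring :: S7 set alg)"
proof -
  interpret B: comm_ai_semiring B by fact
  let ?P = "power_semiring :: S7 set alg"
  \<comment> \<open>This index set has the type that \<open>variety_generated\<close>
    prescribes.\<close>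
  let ?D = "direct_power (UNIV :: ('b \<Rightarrow> S7 set) set) ?P"
  define \<rho> where "\<rho> b = (if b \<in> carr B then b else (SOME c. c \<in> carr B))" for b
  have \<rho>: "\<rho> \<in> UNIV \<rightarrow> carr B"
    using B.nonempty by (auto simp: \<rho>_def some_in_eq)
  define T :: "'b multiset list set" where "T = {t. t \<noteq> [] \<and> {#} \<notin> set t}"
  define F :: "'b multiset list \<Rightarrow> ('b \<Rightarrow> S7 set) \<Rightarrow> S7 set" where "F t = (\<lambda>\<phi>. tval ?P \<phi> t)" for t
  have T: "t \<noteq> []" "{#} \<notin> set t" if "t \<in> T" for t using that by (auto simp: T_def)
  have \<phi>: "\<phi> \<in> UNIV \<rightarrow> carr ?P" for \<phi> :: "'b \<Rightarrow> S7 set" by (simp add: power_semiring_def)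

  \<comment> \<open>Here the criterion meets the axioms: if \<open>t\<close> and \<open>u\<close>
    agree under all assignments into the power semiring, each word of \<open>t\<close> is covered by
    the words of \<open>u\<close>, so the axioms put its value in \<open>B\<close> below that of
    \<open>u\<close>. By symmetry the two values in \<open>B\<close> coincide, which makes
    \<open>h\<close> below well defined.\<close>
  have le: "below B (tval B \<rho> t) (tval B \<rho> u)" if t: "t \<in> T" and u: "u \<in> T" and eq: "F t = F u" for t u
  proof -
    have "below B (wval B \<rho> w) (tval B \<rho> u)" if w: "w \<in> set t" for w
    proof -
      have w0: "w \<noteq> {#}" using w T t by blast
      have "covered w (set u)"
      proof (rule prod_subset_imp_covered)
        fix \<phi>' :: "'b \<Rightarrow> S7 set"
        let ?z = "\<Union>v\<in>set u. \<Prod>x\<in>#v. \<phi>' x"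
        have z: "?z \<in> carr ?P" by (simp add: power_semiring_def)
        have v: "wval ?P \<phi>' v = (\<Prod>x\<in>#v. \<phi>' x)" if "v \<in> set u" for v
          using T[OF u] that by (intro wval_power_semiring) auto
        have "below ?P (tval ?P \<phi>' u) ?z"
          unfolding P7.tval_below_iff[OF \<phi> T[OF u] z]
          using UN_upper[of _ "set u" "\<lambda>v. \<Prod>x\<in>#v. \<phi>' x"] by (simp add: v below_power_semiring)
        moreover have "tval ?P \<phi>' u = tval ?P \<phi>' t" using eq by (metis F_def)
        ultimately have "below ?P (wval ?P \<phi>' w) ?z"
          using P7.tval_below_iff[OF \<phi> T[OF t] z] w by simp
        then show "(\<Prod>x\<in>#w. \<phi>' x) \<subseteq> ?z"
          unfolding below_power_semiring wval_power_semiring[OF w0] .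
      qed
      moreover have z: "tval B \<rho> u \<in> carr B" using B.tval_closed[OF \<rho> T[OF u]] .
      moreover have "below B (wval B \<rho> v) (tval B \<rho> u)" if "v \<in> set u" for v
        using B.tval_below_iff[OF \<rho> T[OF u] z] B.below_refl[OF z] that by blast
      ultimately show ?thesis
        using B.covered_imp_below[OF ax \<rho>] w0 by blast
    qed
    then show ?thesis
      using B.tval_below_iff[OF \<rho> T[OF t] B.tval_closed[OF \<rho> T[OF u]]] by blast
  qed
  have wd: "tval B \<rho> t = tval B \<rho> u" if "t \<in> T" "u \<in> T" "F t = F u" for t u
    using le that B.below_antisym B.tval_closed[OF \<rho>] T by metis
  define h where "h f = tval B \<rho> (SOME t. t \<in> T \<and> F t = f)" for f
  have h: "h (F t) = tval B \<rho> t" if "t \<in> T" for t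
  proof -
    have "\<exists>u. u \<in> T \<and> F u = F t" using that by blast
    from someI_ex[OF this] show ?thesis unfolding h_def using wd that by blast
  qed
  have op: "add ?D (F t) (F u) = F (t @ u)" "mul ?D (F t) (F u) = F (tmul t u)"
    if "t \<in> T" "u \<in> T" for t u
    using that T \<phi> by (auto simp: direct_power_def F_def P7.tval_append P7.tval_tmul)
  have T_op: "t @ u \<in> T" "tmul t u \<in> T" if "t \<in> T" "u \<in> T" for t u
    using that tmul_term[of t u] by (auto simp: T_def)
  have single: "[{#b#}] \<in> T" for b by (simp add: T_def)
  have "subuniverse (F ` T) ?D"
    using single T_op op by (auto simp: subuniverse_def direct_power_def power_semiring_def)
  moreover have "hom_onto h (?D\<lparr>carr := F ` T\<rparr>) B"
  proof -
    have "h ` F ` T = carr B"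
    proof
      show "h ` F ` T \<subseteq> carr B" using h B.tval_closed[OF \<rho>] T by auto
      show "carr B \<subseteq> h ` F ` T"
      proof
        fix b assume "b \<in> carr B"
        \<comment> \<open>Each element of the carrier is the image of the variable named after it,
          as \<open>\<rho>\<close> fixes the carrier.\<close>
        then have "h (F [{#b#}]) = b"
          using h[OF single] B.wval_single[OF \<rho>] by (simp add: tval_def \<rho>_def)
        then show "b \<in> h ` F ` T" using single by (metis imageI)
      qed
    qed
    then show ?thesis
      using T_op T by (auto simp: hom_onto_def op h B.tval_append[OF \<rho>] B.tval_tmul[OF \<rho>])
  qed
  ultimately show ?thesis
    unfolding variety_generated_def image_of_subpower_def by blast
qed

theorem proposition3p8:
  "(variety_generated (power_semiring :: S7 set alg) :: 'b alg set) =
    {B. comm_ai_semiring B \<and>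
        (\<forall>e \<in> {cube_identity} \<union> square_ineqs \<union> linear_ineqs \<union> pair_ineqs. satisfies B e)}"
proof (intro equalityI subsetI CollectI conjI ballI)
  fix B :: "'b alg" assume "B \<in> variety_generated (power_semiring :: S7 set alg)"
  then obtain I :: "('b \<Rightarrow> S7 set) set" and U h
    where sub: "subuniverse U (direct_power I (power_semiring :: S7 set alg))"
    and hom: "hom_onto h (direct_power I (power_semiring :: S7 set alg)\<lparr>carr := U\<rparr>) B"
    by (auto simp: variety_generated_def image_of_subpower_def)
  show "comm_ai_semiring B"
    by (rule image_comm_ai_semiring[OF sub hom P7.comm_ai_semiring_axioms])
  fix e assume "e \<in> {cube_identity} \<union> square_ineqs \<union> linear_ineqs \<union> pair_ineqs"
  then show "satisfies B e"
    using image_satisfies[OF sub hom] power_semiring_satisfies_identities identities_are_terms by blast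
qed (use model_in_variety in blast)

end
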